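(* Let $f\in C(\mathbb{R})$ be nondecreasing. Let $u\in C^2(\mathbb{R}^n)$ be a solution of $$\mathcal{I}u(x)=f(u(x))\quad\text{for any } x\in\mathbb{R}^n.$$ Assume that $$|u(x)|\leq K\,(1+|x|^\kappa)\quad\text{for any } x\in\mathbb{R}^n,$$ for some $K\geq 0$ and $\kappa\in[0,2s)$. Then the following classification holds true: (i) if $f$ is not identically zero, then $u$ is constant, say $u(x)=c$ for any $x\in\mathbb{R}^n$, and $f(c)=0$; (ii) if $f$ is identically zero, then $u$ is an affine function, say $u(x)=\varpi\cdot x+c$, for some $\varpi\in\mathbb{R}^n$ and $c\in\mathbb{R}$; in this case, if additionally $\kappa<1$, then $\varpi=0$ and $u$ is constant.
   Context: Fix $n\geq 1$ and $s\in(0,1)$. Let $\mu$ be a (nonnegative Borel) measure on the unit sphere $S^{n-1}\subset\mathbb{R}^n$ (the "spectral measure") for which there exist $\lambda,\Lambda\in(0,+\infty)$ such that $$\inf_{\nu\in S^{n-1}}\int_{S^{n-1}}|\nu\cdot\vartheta|^{2s}\,d\mu(\vartheta)\geq\lambda\quad\text{and}\quad\mu(S^{n-1})\leq\Lambda.$$ The operator $\mathcal{I}$ is defined by $$\mathcal{I}u(x):=\int_{S^{n-1}\times\mathbb{R}}\big(u(x+\vartheta r)+u(x-\vartheta r)-2u(x)\big)\,\frac{d\mu(\vartheta)\,dr}{|r|^{1+2s}},$$ where $dr$ is Lebesgue measure on $\mathbb{R}$. A solution of $\mathcal{I}u=f(u)$ is a function for which the equation holds pointwise at every $x\in\mathbb{R}^n$.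 *)

theory Defs
  imports "HOL-Analysis.Analysis"
begin

definition C2 :: "(real ^ 'n \<Rightarrow> real) \<Rightarrow> bool" where
  "C2 u \<longleftrightarrow>
    (\<exists>(Du :: real ^ 'n \<Rightarrow> (real ^ 'n) \<Rightarrow>\<^sub>L real)
      (D2u :: real ^ 'n \<Rightarrow> (real ^ 'n) \<Rightarrow>\<^sub>L ((real ^ 'n) \<Rightarrow>\<^sub>L real)).
      (\<forall>x. (u has_derivative blinfun_apply (Du x)) (at x)) \<and>
      (\<forall>x. (Du has_derivative blinfun_apply (D2u x)) (at x)) \<and>
      continuous_on UNIV D2u)"

text \<open>The library has \<open>0 powr 0 = 0\<close>; in the growth condition \<open>0\<close> to the power \<open>0\<close> is \<open>1\<close>.\<close>

definition rpow :: "real \<Rightarrow> real \<Rightarrow> real" where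
  "rpow t a = (if a = 0 then 1 else t powr a)"

text \<open>If \<open>\<mu>\<close> is finite, \<open>0 < s < 1\<close>, \<open>u\<close> is \<open>C2\<close> and grows at most like a power less
  than \<open>2 * s\<close>, the integrand is absolutely integrable for every \<open>x\<close>: near \<open>r = 0\<close> the second
  difference is of order \<open>r\<^sup>2\<close>. So the default value \<open>0\<close> of the Bochner integral of a
  non-integrable function plays no role there. The value \<open>0\<close> of the integrand at
  \<open>r = 0\<close> concerns a null set.\<close>

definition stable_op ::
    "(real ^ 'n) measure \<Rightarrow> real \<Rightarrow> (real ^ 'n \<Rightarrow> real) \<Rightarrow> real ^ 'n \<Rightarrow> real" where
  "stable_op \<mu> s u x =
    (\<integral>(\<theta>, r). (u (x + r *\<^sub>R \<theta>) + u (x - r *\<^sub>R \<theta>) - 2 * u x) / \<bar>r\<bar> powr (1 + 2 * s)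
      \<partial>(\<mu> \<Otimes>\<^sub>M lborel))"

end

theory Submission imports Defs begin

text \<open>
  Why the theorem is true. The nonlinearity disappears first. For \<open>b\<close> strictly between \<open>\<kappa>\<close> and
  \<open>2 * s\<close>, the function \<open>(1 + \<bar>x\<bar>\<^sup>2)\<close> to the power \<open>b / 2\<close> grows faster than \<open>u\<close>, while the
  operator is bounded above on it. Hence \<open>u\<close> minus a small multiple of it attains a maximum, at
  which the operator applied to \<open>u\<close> is almost nonpositive, and monotonicity of \<open>f\<close> carries
  \<open>f (u x) \<le> 0\<close> from there to every \<open>x\<close> (\<open>nonlinearity_nonpos\<close>). The same for \<open>- u\<close> gives
  \<open>f (u x) = 0\<close>, so \<open>u\<close> is harmonic for the operator. If \<open>u\<close> is affine and not constant, it takes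
  all real values, which forces \<open>f = 0\<close>. What remains is a Liouville theorem: harmonic functions
  with growth exponent \<open>\<kappa> < 2 * s\<close> are affine.

  That theorem is proved by an energy argument, without regularity theory or heat kernels. The
  operator is integration of second differences against a Levy measure \<open>\<nu>\<close>. Three
  features of \<open>\<nu>\<close> matter: second differences are integrable, the mass of the jumps seen at scale
  \<open>R\<close> is of order \<open>R powr (- 2 * s)\<close>, and the small jumps generate the whole space. They are collected in
  the locale \<open>levy_scaling\<close>.

  Multiplying the equation \<open>I v = 0\<close> by \<open>v \<eta>\<^sup>2\<close>, with \<open>\<eta>\<close> a cutoff at scale \<open>R\<close>, and integrating bounds
  the energy of \<open>v \<eta>\<close> by \<open>R powr (- 2 * s)\<close> times the mean square of \<open>v\<close> at scale \<open>R\<close>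
  (\<open>energy_bound\<close>). The energy controls the increments \<open>v (x + z) - v x\<close>, and a weighted
  average of these increments over small jumps \<open>z\<close> is again harmonic with the same growth.
  Therefore each passage from \<open>v\<close> to averaged increments gains a factor \<open>R powr (- 2 * s)\<close> in mean
  square (\<open>local_mass_average_diff\<close>). After finitely many passages the gain beats the
  volume and the growth of \<open>u\<close>; letting \<open>R\<close> tend to infinity, all iterated averaged increments of
  that length vanish (\<open>foldr_average_eq_0\<close>).

  It remains to go back. If all averaged increments of \<open>v\<close> are affine, the mixed
  second differences of \<open>v\<close> are invariant under almost all small jumps, hence constant, hence a
  biadditive function of the two steps; as \<open>\<kappa> < 2\<close>, this function is zero and \<open>v\<close> itself is affine
  (\<open>affine_if_averages_affine\<close>). Descending along the iteration shows that \<open>u\<close> is affine. The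
  lower bound on the spectral measure enters through \<open>stable_levy_spanning\<close>, where it makes the jumps
  reach every direction.
\<close>

section \<open>Second differences and functions of controlled growth\<close>

definition second_diff :: "('a::real_vector \<Rightarrow> real) \<Rightarrow> 'a \<Rightarrow> 'a \<Rightarrow> real" where
  "second_diff v x z = v (x + z) + v (x - z) - 2 * v x"

definition levy_op :: "'a::euclidean_space measure \<Rightarrow> ('a \<Rightarrow> real) \<Rightarrow> 'a \<Rightarrow> real" where
  "levy_op \<nu> v x = (\<integral>z. second_diff v x z \<partial>\<nu>)"

text \<open>Up to constants this is the bound, for a function of growth exponent \<open>\<kappa>\<close>, on second differences
  with step \<open>z\<close> at scale \<open>R\<close>: quadratic for steps below \<open>R\<close>, of order \<open>\<kappa>\<close> above.\<close>
definition jump_weight :: "real \<Rightarrow> real \<Rightarrow> 'a::real_normed_vector \<Rightarrow> real" where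
  "jump_weight \<kappa> R z = min 1 ((norm z / R)\<^sup>2) * (1 + norm z / R) powr \<kappa>"

text \<open>The regularity that is used: second derivatives appear only through local quadratic bounds on
  second differences. In this form the condition passes to averages of translates without any
  differentiation under the integral.\<close>
definition tame :: "real \<Rightarrow> ('a::euclidean_space \<Rightarrow> real) \<Rightarrow> bool" where
  "tame \<kappa> v \<longleftrightarrow> continuous_on UNIV v \<and>
     (\<exists>B. \<forall>x. \<bar>v x\<bar> \<le> B * (1 + norm x) powr \<kappa>) \<and>
     (\<forall>M. \<exists>B. \<forall>x z. norm x \<le> M \<longrightarrow> norm z \<le> 1 \<longrightarrow> \<bar>second_diff v x z\<bar> \<le> B * (norm z)\<^sup>2)"

lemma (in pair_sigma_finite) integrable_dominated_by_product:
  fixes f :: "'a \<Rightarrow> 'b \<Rightarrow> real"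
  assumes f: "case_prod f \<in> borel_measurable (M1 \<Otimes>\<^sub>M M2)"
    and a: "integrable M1 a" and b: "integrable M2 b"
    and bound: "\<And>x y. \<bar>f x y\<bar> \<le> a x * b y"
  shows "integrable (M1 \<Otimes>\<^sub>M M2) (case_prod f)"
proof -
  have [measurable]: "a \<in> borel_measurable M1" "b \<in> borel_measurable M2"
    using a b by auto
  have "integrable (M1 \<Otimes>\<^sub>M M2) (\<lambda>(x, y). a x * b y)"
  proof (rule Fubini_integrable)
    show "(\<lambda>(x, y). a x * b y) \<in> borel_measurable (M1 \<Otimes>\<^sub>M M2)" by measurable
    have "integrable M1 (\<lambda>x. \<bar>a x\<bar> * (\<integral>y. \<bar>b y\<bar> \<partial>M2))"
      using a by (intro integrable_mult_left) auto
    then show "integrable M1 (\<lambda>x. \<integral>y. norm (case (x, y) of (x, y) \<Rightarrow> a x * b y) \<partial>M2)"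
      by (simp add: abs_mult)
    show "AE x in M1. integrable M2 (\<lambda>y. case (x, y) of (x, y) \<Rightarrow> a x * b y)"
      using b by auto
  qed
  then show ?thesis
  proof (rule Bochner_Integration.integrable_bound[OF _ f], intro AE_I2)
    fix p
    show "norm (case_prod f p) \<le> norm (case_prod (\<lambda>x y. a x * b y) p)"
      using bound[of "fst p" "snd p"] by (simp add: split_beta)
  qed
qed

text \<open>Cutoffs make every integrand in \<open>x\<close> continuous with bounded support, which settles
  integrability over Lebesgue measure once and for all.\<close>
lemma integrable_continuous_bounded_support:
  fixes f :: "'a::euclidean_space \<Rightarrow> real"
  assumes "continuous_on UNIV f" and supp: "\<And>x. f x \<noteq> 0 \<Longrightarrow> norm x \<le> M"
  shows "integrable lborel f"
proof -
  have "integrable lborel (\<lambda>x. indicator (cball 0 M) x *\<^sub>R f x)"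
    by (rule borel_integrable_compact) (use assms(1) continuous_on_subset in auto)
  also have "(\<lambda>x. indicator (cball 0 M) x *\<^sub>R f x) = f"
    using supp by (auto simp: fun_eq_iff indicator_def)
  finally show ?thesis .
qed

lemma integral_lborel_shift:
  fixes f :: "'a::euclidean_space \<Rightarrow> real"
  assumes "f \<in> borel_measurable borel"
  shows "(\<integral>x. f (x + c) \<partial>lborel) = (\<integral>x. f x \<partial>lborel)"
proof -
  have "(\<integral>x. f x \<partial>lborel) = (\<integral>x. f x \<partial>(distr lborel borel ((+) c)))"
    by (simp add: lborel_distr_plus)
  also have "\<dots> = (\<integral>x. f (c + x) \<partial>lborel)"
    by (rule integral_distr) (use assms in auto)
  finally show ?thesis by (simp add: add.commute)
qed

lemma integrable_lborel_shift:
  fixes f :: "'a::euclidean_space \<Rightarrow> real"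
  assumes "integrable lborel f"
  shows "integrable lborel (\<lambda>x. f (x + c))"
proof -
  have "integrable (distr lborel borel ((+) c)) f"
    using assms by (simp add: lborel_distr_plus)
  then have "integrable lborel (\<lambda>x. f (c + x))"
    by (rule integrable_distr[rotated]) auto
  then show ?thesis by (simp add: add.commute)
qed

lemma tame_cont: "tame \<kappa> v \<Longrightarrow> continuous_on UNIV v"
  by (simp add: tame_def)

lemma tame_measurable: "tame \<kappa> v \<Longrightarrow> v \<in> borel_measurable borel"
  by (intro borel_measurable_continuous_onI tame_cont)

lemma jump_weight_nonneg: "0 \<le> jump_weight \<kappa> R z"
  unfolding jump_weight_def by (intro mult_nonneg_nonneg) auto

lemma jump_weight_measurable [measurable]:
  "jump_weight \<kappa> R \<in> borel_measurable (borel :: 'a::euclidean_space measure)"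
  unfolding jump_weight_def by measurable

lemma tame_growth:
  assumes "tame \<kappa> v"
  obtains B where "B \<ge> 0" "\<And>x. \<bar>v x\<bar> \<le> B * (1 + norm x) powr \<kappa>"
proof -
  obtain B where B: "\<And>x. \<bar>v x\<bar> \<le> B * (1 + norm x) powr \<kappa>"
    using assms by (auto simp: tame_def)
  have "0 \<le> B" using B[of 0] by auto
  then show ?thesis using that B by blast
qed

text \<open>Near \<open>z = 0\<close> the quadratic bound applies, away from it the growth of \<open>v\<close>; the constant is
  uniform for \<open>x\<close> in a ball, which is what the later exchanges of integrals require.\<close>
lemma tame_second_diff_bound:
  assumes v: "tame \<kappa> v" and k: "0 \<le> \<kappa>"
  obtains C where "C \<ge> 0" "\<And>x z. norm x \<le> M \<Longrightarrow> \<bar>second_diff v x z\<bar> \<le> C * jump_weight \<kappa> 1 z"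
proof -
  obtain B where B: "B \<ge> 0" "\<And>x. \<bar>v x\<bar> \<le> B * (1 + norm x) powr \<kappa>"
    using tame_growth[OF v] by blast
  obtain D where D: "\<And>x z. norm x \<le> M \<Longrightarrow> norm z \<le> 1 \<Longrightarrow> \<bar>second_diff v x z\<bar> \<le> D * (norm z)\<^sup>2"
    using v unfolding tame_def by blast
  define C where "C = \<bar>D\<bar> + 4 * B * (1 + \<bar>M\<bar>) powr \<kappa>"
  have nn: "0 \<le> 4 * B * (1 + \<bar>M\<bar>) powr \<kappa>" using B(1) by simp
  then have C0: "C \<ge> 0" and DC: "D \<le> C" and BC: "4 * B * (1 + \<bar>M\<bar>) powr \<kappa> \<le> C"
    unfolding C_def by linarith+
  have main: "\<bar>second_diff v x z\<bar> \<le> C * jump_weight \<kappa> 1 z" if x: "norm x \<le> M" for x z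
  proof (cases "norm z \<le> 1")
    case True
    have "\<bar>second_diff v x z\<bar> \<le> D * (norm z)\<^sup>2" using D[OF x True] .
    also have "\<dots> \<le> C * (norm z)\<^sup>2"
      using DC by (intro mult_right_mono) auto
    also have "\<dots> = C * (min 1 ((norm z / 1)\<^sup>2) * 1)"
      using True by (simp add: power_le_one min_absorb2)
    also have "\<dots> \<le> C * jump_weight \<kappa> 1 z"
      unfolding jump_weight_def using C0 k
      by (intro mult_left_mono) (auto simp: ge_one_powr_ge_zero)
    finally show ?thesis .
  next
    case False
    have each: "\<bar>v y\<bar> \<le> B * ((1 + \<bar>M\<bar>) powr \<kappa> * (1 + norm z) powr \<kappa>)" if "norm y \<le> norm x + norm z" for y
    proof -
      have "1 + norm y \<le> (1 + \<bar>M\<bar>) * (1 + norm z)"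
      proof -
        have "norm y \<le> \<bar>M\<bar> + norm z" using that x by linarith
        moreover have "0 \<le> \<bar>M\<bar> * norm z" by simp
        ultimately show ?thesis by (simp only: distrib_left distrib_right mult_1 mult_1_right)
      qed
      then have "(1 + norm y) powr \<kappa> \<le> ((1 + \<bar>M\<bar>) * (1 + norm z)) powr \<kappa>"
        using k by (intro powr_mono2) auto
      also have "\<dots> = (1 + \<bar>M\<bar>) powr \<kappa> * (1 + norm z) powr \<kappa>"
        by (simp add: powr_mult)
      finally show ?thesis using B(2)[of y] B(1) by (meson mult_left_mono order_trans)
    qed
    have "\<bar>second_diff v x z\<bar> \<le> \<bar>v (x + z)\<bar> + \<bar>v (x - z)\<bar> + 2 * \<bar>v x\<bar>"
      unfolding second_diff_def by linarith
    also have "\<dots> \<le> 4 * (B * ((1 + \<bar>M\<bar>) powr \<kappa> * (1 + norm z) powr \<kappa>))"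
      using each[of "x + z"] each[of "x - z"] each[of x] norm_triangle_ineq[of x z] norm_triangle_ineq4[of x z]
      by simp
    also have "\<dots> = (4 * B * (1 + \<bar>M\<bar>) powr \<kappa>) * (1 + norm z) powr \<kappa>" by simp
    also have "\<dots> \<le> C * (1 + norm z) powr \<kappa>"
      using BC by (intro mult_right_mono) auto
    also have "\<dots> = C * jump_weight \<kappa> 1 z"
      using False by (simp add: jump_weight_def min_def one_le_power)
    finally show ?thesis .
  qed
  show ?thesis using that C0 main by blast
qed

text \<open>The derivative is Lipschitz on each ball because the second derivative is bounded there, so \<open>u\<close> differs from its
  tangent by a quadratic error; in the second difference the two tangent terms cancel.\<close>
lemma tame_C2:
  fixes u :: "real ^ 'n \<Rightarrow> real"
  assumes "C2 u" and g: "\<And>x. \<bar>u x\<bar> \<le> B * (1 + norm x) powr \<kappa>"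
  shows "tame \<kappa> u"
proof -
  obtain Du :: "real ^ 'n \<Rightarrow> (real ^ 'n) \<Rightarrow>\<^sub>L real" and 
      D2u :: "real ^ 'n \<Rightarrow> (real ^ 'n) \<Rightarrow>\<^sub>L ((real ^ 'n) \<Rightarrow>\<^sub>L real)"
    where Du: "\<And>x. (u has_derivative blinfun_apply (Du x)) (at x)"
      and D2: "\<And>x. (Du has_derivative blinfun_apply (D2u x)) (at x)"
      and cont: "continuous_on UNIV D2u"
    using assms(1) unfolding C2_def by blast
  have "continuous_on UNIV u"
    by (intro continuous_at_imp_continuous_on ballI has_derivative_continuous[OF Du])
  moreover have "\<exists>B. \<forall>x z. norm x \<le> M \<longrightarrow> norm z \<le> 1 \<longrightarrow> \<bar>second_diff u x z\<bar> \<le> B * (norm z)\<^sup>2" for M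
  proof -
    have "compact (D2u ` cball 0 (M + 1))"
      by (intro compact_continuous_image continuous_on_subset[OF cont]) auto
    then obtain A where A: "\<And>y. y \<in> cball 0 (M + 1) \<Longrightarrow> norm (D2u y) \<le> A"
      by (metis compact_imp_bounded bounded_iff imageI)
    have lip: "norm (Du y - Du x) \<le> A * norm (y - x)" if "norm x \<le> M + 1" "norm y \<le> M + 1" for x y
    proof (rule differentiable_bound[where S = "cball 0 (M + 1)" and f' = "\<lambda>x. blinfun_apply (D2u x)"])
      show "(Du has_derivative blinfun_apply (D2u y)) (at y within cball 0 (M + 1))" for y
        by (rule has_derivative_at_withinI[OF D2])
      show "onorm (blinfun_apply (D2u y)) \<le> A" if "y \<in> cball 0 (M + 1)" for y
        using A[OF that] by (simp add: norm_blinfun.rep_eq)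
    qed (use that in auto)
    have lin: "\<bar>u (x + w) - u x - Du x w\<bar> \<le> \<bar>A\<bar> * (norm w)\<^sup>2" if "norm x \<le> M" "norm w \<le> 1" for x w
    proof -
      have "norm ((u (x + w) - Du x (x + w)) - (u x - Du x x)) \<le> (\<bar>A\<bar> * norm w) * norm ((x + w) - x)"
      proof (rule differentiable_bound[where S = "cball x (norm w)" and f' = "\<lambda>y. blinfun_apply (Du y - Du x)" and f="\<lambda>y. u y - Du x y"])
        fix y assume y: "y \<in> cball x (norm w)"
        show "((\<lambda>y. u y - Du x y) has_derivative blinfun_apply (Du y - Du x)) (at y within cball x (norm w))"
          by (rule has_derivative_eq_rhs, rule has_derivative_diff[OF has_derivative_at_withinI[OF Du]
                bounded_linear_imp_has_derivative[OF blinfun.bounded_linear_right]])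
             (simp add: fun_eq_iff blinfun.diff_left)
        have ny: "norm (y - x) \<le> norm w" using y by (simp add: dist_norm norm_minus_commute)
        have "norm y \<le> norm x + norm (y - x)" by (metis add.commute diff_add_cancel norm_triangle_ineq)
        then have "norm (Du y - Du x) \<le> A * norm (y - x)" using that ny by (intro lip) auto
        also have "\<dots> \<le> \<bar>A\<bar> * norm w" using ny by (intro mult_mono) auto
        finally show "onorm (blinfun_apply (Du y - Du x)) \<le> \<bar>A\<bar> * norm w"
          by (simp add: norm_blinfun.rep_eq)
      qed (auto simp: dist_norm)
      then show ?thesis by (simp add: blinfun.add_right power2_eq_square algebra_simps)
    qed
    have "\<bar>second_diff u x z\<bar> \<le> (2 * \<bar>A\<bar>) * (norm z)\<^sup>2" if "norm x \<le> M" "norm z \<le> 1" for x z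
      using lin[of x z] lin[of x "- z"] that
      by (simp add: second_diff_def blinfun.minus_right)
    then show ?thesis by blast
  qed
  ultimately show ?thesis using g unfolding tame_def by blast
qed

section \<open>Local mass, cutoffs and averaged increments\<close>

lemma sets_borel_ball [measurable]:
  fixes c :: "'a::euclidean_space"
  shows "ball c r \<in> sets borel" "cball c r \<in> sets borel"
  by auto

definition local_mass :: "('a::euclidean_space \<Rightarrow> real) \<Rightarrow> 'a \<Rightarrow> real \<Rightarrow> real" where
  "local_mass v c r = (\<integral>x. indicator (ball c r) x * (v x)\<^sup>2 \<partial>lborel)"

lemma integrable_indicator_ball:
  fixes g :: "'a::euclidean_space \<Rightarrow> real"
  assumes g: "continuous_on UNIV g"
  shows "integrable lborel (\<lambda>x. indicator (ball c r) x * g x)"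
proof -
  have [measurable]: "g \<in> borel_measurable borel"
    by (rule borel_measurable_continuous_onI[OF g])
  have "integrable lborel (\<lambda>x. indicator (cball c r) x *\<^sub>R g x)"
    by (rule borel_integrable_compact) (use g continuous_on_subset in auto)
  then show ?thesis
    by (rule Bochner_Integration.integrable_bound) (auto simp: indicator_def)
qed

lemma local_mass_shift:
  fixes v :: "'a::euclidean_space \<Rightarrow> real"
  assumes v: "continuous_on UNIV v"
  shows "(\<integral>x. indicator (ball c r) x * (v (x + z))\<^sup>2 \<partial>lborel) = local_mass v (c + z) r"
proof -
  have [measurable]: "v \<in> borel_measurable borel"
    by (rule borel_measurable_continuous_onI[OF v])
  have "indicator (ball c r) x = (indicator (ball (c + z) r) (x + z) :: real)" for x
    by (simp add: indicator_def dist_norm)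
  then have "(\<integral>x. indicator (ball c r) x * (v (x + z))\<^sup>2 \<partial>lborel)
      = (\<integral>x. (\<lambda>y. indicator (ball (c + z) r) y * (v y)\<^sup>2) (x + z) \<partial>lborel)"
    by simp
  also have "\<dots> = local_mass v (c + z) r"
    unfolding local_mass_def by (rule integral_lborel_shift) measurable
  finally show ?thesis .
qed

text \<open>Translating the centre by \<open>z\<close> costs the factor that appears in \<open>jump_weight \<kappa> R z\<close>; this is why the
  weight \<open>(R + norm c) powr \<kappa>\<close> is used for mass around \<open>c\<close> at scale \<open>R\<close>.\<close>
lemma weight_shift:
  fixes c z :: "'a::real_normed_vector"
  assumes "1 \<le> R" "0 \<le> \<kappa>"
  shows "(R + norm (c + z)) powr \<kappa> \<le> (R + norm c) powr \<kappa> * (1 + norm z / R) powr \<kappa>"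
proof -
  have "(R + norm c) * (1 + norm z / R) = R + norm c + norm z + norm c * norm z / R"
    using assms by (simp add: field_simps)
  moreover have "0 \<le> norm c * norm z / R" using assms by simp
  ultimately have "R + norm (c + z) \<le> (R + norm c) * (1 + norm z / R)"
    using norm_triangle_ineq[of c z] by linarith
  then have "(R + norm (c + z)) powr \<kappa> \<le> ((R + norm c) * (1 + norm z / R)) powr \<kappa>"
    using assms by (intro powr_mono2) auto
  then show ?thesis using assms by (simp add: powr_mult)
qed

text \<open>Expand the nonnegative integral of \<open>q * (f - c)\<^sup>2\<close>. Taking \<open>1 + \<integral>q\<close> in place of \<open>\<integral>q\<close>, in the
  choice of \<open>c\<close> and in the conclusion, avoids a separate case of vanishing total weight.\<close>
lemma weighted_cauchy_schwarz:
  fixes f q :: "'a \<Rightarrow> real"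
  assumes q: "integrable M q" and q0: "\<And>x. 0 \<le> q x"
    and f: "integrable M (\<lambda>x. q x * f x)" and f2: "integrable M (\<lambda>x. q x * (f x)\<^sup>2)"
  shows "(\<integral>x. q x * f x \<partial>M)\<^sup>2 \<le> (1 + (\<integral>x. q x \<partial>M)) * (\<integral>x. q x * (f x)\<^sup>2 \<partial>M)"
proof -
  define I where "I = (\<integral>x. q x * f x \<partial>M)"
  define m where "m = (\<integral>x. q x \<partial>M)"
  define S where "S = (\<integral>x. q x * (f x)\<^sup>2 \<partial>M)"
  have m: "0 \<le> m" unfolding m_def using q0 by (simp add: integral_nonneg_AE)
  define c where "c = I / (1 + m)"
  have "0 \<le> (\<integral>x. q x * (f x - c)\<^sup>2 \<partial>M)" using q0 by (simp add: integral_nonneg_AE)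
  also have "(\<lambda>x. q x * (f x - c)\<^sup>2) = (\<lambda>x. q x * (f x)\<^sup>2 - (2 * c) * (q x * f x) + c\<^sup>2 * q x)"
    by (auto simp: power2_eq_square algebra_simps)
  also have "(\<integral>x. q x * (f x)\<^sup>2 - (2 * c) * (q x * f x) + c\<^sup>2 * q x \<partial>M) = S - 2 * c * I + c\<^sup>2 * m"
    unfolding S_def I_def m_def using q f f2 by simp
  finally have "0 \<le> S - 2 * c * I + c\<^sup>2 * m" .
  moreover have "c\<^sup>2 * m \<le> c\<^sup>2 * (1 + m)" by (intro mult_left_mono) auto
  moreover have "c\<^sup>2 * (1 + m) = c * I"
    using m by (simp add: c_def power2_eq_square)
  ultimately have "c * I \<le> S" by linarith
  then have "c * I * (1 + m) \<le> S * (1 + m)" using m by (intro mult_right_mono) auto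
  moreover have "c * I * (1 + m) = I\<^sup>2" using m by (simp add: c_def power2_eq_square)
  ultimately show ?thesis unfolding I_def m_def S_def by (simp add: mult.commute)
qed

definition cutoff :: "'a::real_normed_vector \<Rightarrow> real \<Rightarrow> 'a \<Rightarrow> real" where
  "cutoff c r x = max 0 (min 1 (2 - norm (x - c) / r))"

lemma cutoff_inner: "0 < r \<Longrightarrow> x \<in> ball c r \<Longrightarrow> cutoff c r x = 1"
  by (simp add: cutoff_def dist_norm norm_minus_commute field_simps min_def max_def)

lemma cutoff_support: "0 < r \<Longrightarrow> cutoff c r x \<noteq> 0 \<Longrightarrow> x \<in> ball c (2 * r)"
  by (auto simp: cutoff_def dist_norm norm_minus_commute field_simps min_def max_def split: if_splits)

lemma cutoff_continuous: "0 < r \<Longrightarrow> continuous_on UNIV (cutoff c r)"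
  unfolding cutoff_def[abs_def] by (intro continuous_intros) auto

text \<open>The cutoff is Lipschitz with constant \<open>1 / r\<close> and bounded by one, and its increment vanishes
  unless one of the two points lies in the support.\<close>
lemma cutoff_diff:
  assumes "1 \<le> R" "R \<le> r"
  shows "(cutoff c r (x + z) - cutoff c r x)\<^sup>2
    \<le> min 1 ((norm z / R)\<^sup>2) * (indicator (ball c (2 * r)) x + indicator (ball c (2 * r)) (x + z))"
proof (cases "cutoff c r (x + z) = 0 \<and> cutoff c r x = 0")
  case True
  then show ?thesis by simp
next
  case False
  have r: "0 < r" using assms by simp
  define d where "d = \<bar>cutoff c r (x + z) - cutoff c r x\<bar>"
  have "d \<le> \<bar>norm (x + z - c) / r - norm (x - c) / r\<bar>"
    unfolding d_def cutoff_def by linarith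
  also have "\<dots> = \<bar>norm (x + z - c) - norm (x - c)\<bar> / r"
    using r by (simp add: diff_divide_distrib[symmetric])
  also have "\<dots> \<le> norm z / r"
    using norm_triangle_ineq3[of "x + z - c" "x - c"] r by (intro divide_right_mono) auto
  also have "\<dots> \<le> norm z / R" using assms by (intro divide_left_mono) auto
  finally have "d \<le> norm z / R" .
  moreover have "d \<le> 1" unfolding d_def cutoff_def by linarith
  moreover have "0 \<le> d" unfolding d_def by simp
  ultimately have "d\<^sup>2 \<le> min 1 ((norm z / R)\<^sup>2)"
    using power_mono[of d "norm z / R" 2] by (auto simp: power_le_one)
  also have "\<dots> \<le> min 1 ((norm z / R)\<^sup>2) * (indicator (ball c (2 * r)) x + indicator (ball c (2 * r)) (x + z))"
  proof -
    have "(1::real) \<le> indicator (ball c (2 * r)) x + indicator (ball c (2 * r)) (x + z)"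
      using False cutoff_support[OF r, of c x] cutoff_support[OF r, of c "x + z"] by (auto simp: indicator_def)
    then have "min 1 ((norm z / R)\<^sup>2) * 1 \<le> min 1 ((norm z / R)\<^sup>2) *
        (indicator (ball c (2 * r)) x + indicator (ball c (2 * r)) (x + z))"
      by (intro mult_left_mono) auto
    then show ?thesis by simp
  qed
  finally show ?thesis by (simp add: d_def)
qed

text \<open>The factor \<open>(norm z)\<^sup>2\<close> makes the small jumps a finite measure; the restriction to jumps of length
  at most one keeps averaged increments local.\<close>
definition near_weight :: "'a::real_normed_vector \<Rightarrow> real" where
  "near_weight z = indicator (cball 0 1) z * (norm z)\<^sup>2"

definition average_diff ::
    "'a::euclidean_space measure \<Rightarrow> ('a \<Rightarrow> real) \<Rightarrow> ('a \<Rightarrow> real) \<Rightarrow> 'a \<Rightarrow> real" where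
  "average_diff \<nu> g v x = (\<integral>z. near_weight z * (g z * (v (x + z) - v x)) \<partial>\<nu>)"

lemma near_weight_range: "0 \<le> near_weight z" "near_weight z \<le> 1"
  by (auto simp: near_weight_def indicator_def power_le_one)

lemma near_weight_measurable [measurable]:
  "near_weight \<in> borel_measurable (borel :: 'a::euclidean_space measure)"
  unfolding near_weight_def by measurable

lemma near_weight_le: 
  assumes "0 \<le> \<kappa>" shows "near_weight z \<le> jump_weight \<kappa> 1 z"
proof (cases "norm z \<le> 1")
  case True
  have "(norm z)\<^sup>2 * 1 \<le> (norm z)\<^sup>2 * (1 + norm z) powr \<kappa>"
    using assms by (intro mult_left_mono) (auto simp: ge_one_powr_ge_zero)
  with True show ?thesis
    by (simp add: near_weight_def jump_weight_def min_absorb2 power_le_one)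
next
  case False
  then show ?thesis using jump_weight_nonneg[of \<kappa> 1 z] by (simp add: near_weight_def)
qed

lemma tame_locally_bounded:
  assumes v: "tame \<kappa> v" and k: "0 \<le> \<kappa>"
  obtains C where "C \<ge> 0" "\<And>x. norm x \<le> M \<Longrightarrow> \<bar>v x\<bar> \<le> C"
proof -
  obtain B where B: "B \<ge> 0" "\<And>x. \<bar>v x\<bar> \<le> B * (1 + norm x) powr \<kappa>"
    using tame_growth[OF v] by blast
  have "\<bar>v x\<bar> \<le> B * (1 + \<bar>M\<bar>) powr \<kappa>" if "norm x \<le> M" for x
  proof -
    have "B * (1 + norm x) powr \<kappa> \<le> B * (1 + \<bar>M\<bar>) powr \<kappa>"
      using that k B(1) by (intro mult_left_mono powr_mono2) auto
    then show ?thesis using B(2)[of x] by linarith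
  qed
  moreover have "0 \<le> B * (1 + \<bar>M\<bar>) powr \<kappa>" using B(1) by simp
  ultimately show ?thesis using that by blast
qed

text \<open>The density \<open>g\<close> in \<open>average_diff\<close> is arbitrary apart from its bound. This freedom makes it possible to test
  against a density chosen after \<open>v\<close>.\<close>
definition unit_multiplier :: "('a::euclidean_space \<Rightarrow> real) \<Rightarrow> bool" where
  "unit_multiplier g \<longleftrightarrow> g \<in> borel_measurable borel \<and> (\<forall>z. \<bar>g z\<bar> \<le> 1)"

lemma unit_multiplierD:
  assumes "unit_multiplier g"
  shows "g \<in> borel_measurable borel" "\<bar>g z\<bar> \<le> 1"
  using assms by (auto simp: unit_multiplier_def)

lemma near_weight_mult_bound:
  assumes "\<And>z. norm z \<le> 1 \<Longrightarrow> \<bar>h z\<bar> \<le> C" 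
  shows "\<bar>near_weight z * h z\<bar> \<le> near_weight z * C"
proof (cases "norm z \<le> 1")
  case True
  then show ?thesis using assms[OF True] near_weight_range[of z] by (auto simp: abs_mult intro!: mult_left_mono)
next
  case False
  then show ?thesis by (simp add: near_weight_def)
qed

section \<open>Levy measures that scale like a stable operator\<close>

text \<open>The properties of the Levy measure from which the Liouville theorem follows. The first bound is
  integrability of second differences, the second is scaling with exponent \<open>2 * s\<close>, and \<open>spanning\<close> says
  that no proper closed subgroup carries almost all jumps of length at most one.\<close>
locale levy_scaling =
  fixes \<nu> :: "'a::euclidean_space measure" and s \<kappa> J :: real
  assumes sigma_finite_nu: "sigma_finite_measure \<nu>"
    and sets_nu [measurable_cong]: "sets \<nu> = sets borel"
    and s_pos: "0 < s"
    and kappa_nonneg: "0 \<le> \<kappa>" and kappa_less_2: "\<kappa> < 2"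
    and integrable_jump_weight: "\<And>R. 1 \<le> R \<Longrightarrow> integrable \<nu> (jump_weight \<kappa> R)"
    and jump_weight_scaling: "\<And>R. 1 \<le> R \<Longrightarrow> (\<integral>z. jump_weight \<kappa> R z \<partial>\<nu>) \<le> J * R powr (- 2 * s)"
    and spanning: "\<And>P. closed P \<Longrightarrow> 0 \<in> P \<Longrightarrow> (\<And>x y. x \<in> P \<Longrightarrow> y \<in> P \<Longrightarrow> x + y \<in> P) \<Longrightarrow>
      (\<And>x. x \<in> P \<Longrightarrow> - x \<in> P) \<Longrightarrow>
      (AE z in \<nu>. norm z \<le> 1 \<longrightarrow> z \<in> P) \<Longrightarrow> P = UNIV"
begin

sublocale sigma_finite_measure \<nu> by (rule sigma_finite_nu)
sublocale LN: pair_sigma_finite lborel \<nu> ..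
sublocale NN: pair_sigma_finite \<nu> \<nu> ..

definition harmonic :: "('a \<Rightarrow> real) \<Rightarrow> bool" where
  "harmonic v \<longleftrightarrow> tame \<kappa> v \<and> (\<forall>x. levy_op \<nu> v x = 0)"

lemma space_nu [simp]: "space \<nu> = UNIV"
  using sets_eq_imp_space_eq[OF sets_nu] by simp

lemma integrable_near_weight: "integrable \<nu> near_weight"
proof (rule Bochner_Integration.integrable_bound[OF integrable_jump_weight[of 1]])
  show "AE z in \<nu>. norm (near_weight z) \<le> norm (jump_weight \<kappa> 1 z)"
    by (rule AE_I2) (simp add: near_weight_le[OF kappa_nonneg] near_weight_range jump_weight_nonneg)
qed auto

text \<open>Young's inequality with the weight \<open>t = (1 + norm z / R) powr \<kappa>\<close>: the mass around the translated
  centre is larger by at most the factor \<open>t\<^sup>2\<close>, so this weight balances the two squares and only one factor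
  \<open>t\<close> remains. It is this single factor that is integrable against \<open>\<nu>\<close> for \<open>\<kappa> < 2 * s\<close>.\<close>
lemma cross_term_bound:
  assumes v: "continuous_on UNIV v" and R: "1 \<le> R"
    and mass: "\<And>c. local_mass v c r \<le> B * ((R + norm c) powr \<kappa>)\<^sup>2"
  shows "(\<integral>x. indicator (ball c r) x * (\<bar>v x\<bar> * \<bar>v (x + z)\<bar>) \<partial>lborel)
    \<le> B * ((R + norm c) powr \<kappa>)\<^sup>2 * (1 + norm z / R) powr \<kappa>"
proof -
  define t where "t = (1 + norm z / R) powr \<kappa>"
  define p where "p = (R + norm c) powr \<kappa>"
  have t: "1 \<le> t" unfolding t_def using R kappa_nonneg by (simp add: ge_one_powr_ge_zero)
  have p: "0 < p" unfolding p_def using R norm_ge_zero[of c] by (simp only: powr_gt_zero)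
  have "0 \<le> B * p\<^sup>2"
  proof -
    have "0 \<le> local_mass v c r" unfolding local_mass_def by (simp add: integral_nonneg_AE)
    then show ?thesis using mass[of c] unfolding p_def by linarith
  qed
  then have B: "0 \<le> B" using p by (simp add: zero_le_mult_iff)
  have vz: "continuous_on UNIV (\<lambda>x. v (x + z))"
    by (intro continuous_on_compose2[OF v] continuous_intros) auto
  have int0: "integrable lborel (\<lambda>x. indicator (ball c r) x * (\<bar>v x\<bar> * \<bar>v (x + z)\<bar>))"
   and int1: "integrable lborel (\<lambda>x. indicator (ball c r) x * (v x)\<^sup>2)"
   and int2: "integrable lborel (\<lambda>x. indicator (ball c r) x * (v (x + z))\<^sup>2)"
    by (intro integrable_indicator_ball continuous_intros v vz)+
  have young: "\<bar>a\<bar> * \<bar>b\<bar> \<le> (t * a\<^sup>2 + b\<^sup>2 / t) / 2" for a b :: real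
  proof -
    have "0 \<le> (t * \<bar>a\<bar> - \<bar>b\<bar>)\<^sup>2 / t" using t by simp
    also have "(t * \<bar>a\<bar> - \<bar>b\<bar>)\<^sup>2 / t = t * a\<^sup>2 + b\<^sup>2 / t - 2 * (\<bar>a\<bar> * \<bar>b\<bar>)"
    proof -
      have "(t * \<bar>a\<bar> - \<bar>b\<bar>)\<^sup>2 = t\<^sup>2 * a\<^sup>2 + b\<^sup>2 - 2 * t * (\<bar>a\<bar> * \<bar>b\<bar>)"
        by (simp add: power2_diff power_mult_distrib)
      then show ?thesis using t by (simp add: field_simps power2_eq_square)
    qed
    finally have "2 * (\<bar>a\<bar> * \<bar>b\<bar>) \<le> t * a\<^sup>2 + b\<^sup>2 / t" by (simp only: diff_ge_0_iff_ge)
    then show ?thesis by (simp only: le_divide_eq_numeral1 mult.commute[of _ 2])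
  qed
  have "local_mass v (c + z) r \<le> B * ((R + norm (c + z)) powr \<kappa>)\<^sup>2" by (rule mass)
  also have "\<dots> \<le> B * (p * t)\<^sup>2"
    unfolding p_def t_def using B weight_shift[OF R kappa_nonneg, of c z]
    by (intro mult_left_mono power_mono) auto
  finally have mz: "local_mass v (c + z) r / t \<le> B * p\<^sup>2 * t"
    using t by (simp add: field_simps power2_eq_square)
  have m0: "t * local_mass v c r \<le> t * (B * p\<^sup>2)"
    unfolding p_def using t mass by (intro mult_left_mono) auto
  have "(\<integral>x. indicator (ball c r) x * (\<bar>v x\<bar> * \<bar>v (x + z)\<bar>) \<partial>lborel)
    \<le> (\<integral>x. (t * (indicator (ball c r) x * (v x)\<^sup>2) + (indicator (ball c r) x * (v (x + z))\<^sup>2) / t) / 2 \<partial>lborel)"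
    by (rule integral_mono)
      (use int0 int1 int2 young in \<open>auto simp: indicator_def\<close>)
  also have "\<dots> = (t * local_mass v c r + local_mass v (c + z) r / t) / 2"
    unfolding local_mass_shift[OF v, symmetric] unfolding local_mass_def using int1 int2 by simp
  also have "\<dots> \<le> B * p\<^sup>2 * t" using mz m0 by (simp add: algebra_simps)
  finally show ?thesis unfolding p_def t_def .
qed

end

section \<open>The energy of a localized harmonic function\<close>

context levy_scaling begin

lemma integrable_second_diff:
  assumes "tame \<kappa> v"
  shows "integrable \<nu> (second_diff v x)"
proof -
  note tame_measurable[OF assms, measurable]
  obtain C where C: "C \<ge> 0" "\<And>y z. norm y \<le> norm x \<Longrightarrow> \<bar>second_diff v y z\<bar> \<le> C * jump_weight \<kappa> 1 z"
    using tame_second_diff_bound[OF assms kappa_nonneg] by blast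
  have "integrable \<nu> (\<lambda>z. C * jump_weight \<kappa> 1 z)" using integrable_jump_weight[of 1] by simp
  then show ?thesis
  proof (rule Bochner_Integration.integrable_bound)
    show "second_diff v x \<in> borel_measurable \<nu>" unfolding second_diff_def by measurable
    show "AE z in \<nu>. norm (second_diff v x z) \<le> norm (C * jump_weight \<kappa> 1 z)"
      using C(2)[OF order_refl] by (intro AE_I2) (simp add: order_trans[OF _ abs_ge_self])
  qed
qed

text \<open>The Caccioppoli inequality. Test \<open>I v = 0\<close> with \<open>v \<eta>\<^sup>2\<close>, where \<open>\<eta>\<close> is the cutoff. For each jump, with primes
  denoting translated values,
  \<open>(v' - v) * (v' * \<eta>'\<^sup>2 - v * \<eta>\<^sup>2) = (v' * \<eta>' - v * \<eta>)\<^sup>2 - v * v' * (\<eta>' - \<eta>)\<^sup>2\<close>. The square on the right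
  is the energy and the other term involves no differences of \<open>v\<close>, so it is bounded by the mass of \<open>v\<close>.\<close>
lemma energy_bound:
  fixes c :: 'a
  assumes v: "harmonic v" and R: "1 \<le> R" "R \<le> r"
    and mass: "\<And>c. local_mass v c (2 * r) \<le> B * ((R + norm c) powr \<kappa>)\<^sup>2"
  defines "e \<equiv> \<lambda>z. \<integral>x. (v (x + z) * cutoff c r (x + z) - v x * cutoff c r x)\<^sup>2 \<partial>lborel"
  shows "integrable \<nu> e" 
    and "(\<integral>z. e z \<partial>\<nu>) \<le> 2 * B * ((R + norm c) powr \<kappa>)\<^sup>2 * (J * R powr (- 2 * s))"
proof -
  define \<eta> where "\<eta> = cutoff c r"
  define p where "p = (R + norm c) powr \<kappa>"
  define M where "M = norm c + 2 * r"
  define \<phi> where "\<phi> x = v x * (\<eta> x)\<^sup>2" for x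
  define b where "b z = (\<integral>x. v x * v (x + z) * (\<eta> (x + z) - \<eta> x)\<^sup>2 \<partial>lborel)" for z
  have r: "0 < r" using R by simp
  have vt: "tame \<kappa> v" and op: "\<And>x. levy_op \<nu> v x = 0" using v by (auto simp: harmonic_def)
  have vc: "continuous_on UNIV v" using tame_cont[OF vt] .
  have hc: "continuous_on UNIV \<eta>" unfolding \<eta>_def by (rule cutoff_continuous[OF r])
  have [measurable]: "v \<in> borel_measurable borel" "\<eta> \<in> borel_measurable borel"
    by (auto intro!: borel_measurable_continuous_onI vc hc)
  have supp: "norm x \<le> M" if "\<eta> x \<noteq> 0" for x
  proof -
    have "dist c x < 2 * r" using cutoff_support[OF r, of c x] that by (simp add: \<eta>_def)
    then show ?thesis using norm_triangle_sub[of x c] by (simp add: M_def dist_norm norm_minus_commute)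
  qed
  have supp': "norm x \<le> M + norm z" if "\<eta> (x + z) \<noteq> 0" for x z
    using supp[OF that] norm_triangle_ineq4[of "x + z" z] by simp
  have shiftc: "continuous_on UNIV (\<lambda>x. g (x + z))" if "continuous_on UNIV g" for g :: "'a \<Rightarrow> real" and z
    by (intro continuous_on_compose2[OF that] continuous_intros) auto
  have shiftc': "continuous_on UNIV (\<lambda>x. g (x - z))" if "continuous_on UNIV g" for g :: "'a \<Rightarrow> real" and z
    by (intro continuous_on_compose2[OF that] continuous_intros) auto
  note cont = vc hc shiftc[OF vc] shiftc[OF hc] shiftc'[OF vc]
  have phi_c: "continuous_on UNIV \<phi>" unfolding \<phi>_def by (intro continuous_intros cont)
  have [measurable]: "\<phi> \<in> borel_measurable borel"
    by (intro borel_measurable_continuous_onI phi_c)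
  have phi_supp: "norm x \<le> M" if "\<phi> x \<noteq> 0" for x
    using that supp by (auto simp: \<phi>_def)
  have phi_int: "integrable lborel (\<lambda>x. \<bar>\<phi> x\<bar>)"
    by (rule integrable_continuous_bounded_support[where M = M])
      (use phi_supp in \<open>auto intro!: continuous_intros phi_c\<close>)
  have int_b: "integrable lborel (\<lambda>x. v x * v (x + z) * (\<eta> (x + z) - \<eta> x)\<^sup>2)" for z
  proof (rule integrable_continuous_bounded_support[where M = "M + norm z"])
    show "continuous_on UNIV (\<lambda>x. v x * v (x + z) * (\<eta> (x + z) - \<eta> x)\<^sup>2)"
      by (intro continuous_intros cont)
    fix x assume "v x * v (x + z) * (\<eta> (x + z) - \<eta> x)\<^sup>2 \<noteq> 0"
    then have "\<eta> (x + z) \<noteq> 0 \<or> \<eta> x \<noteq> 0" by auto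
    then show "norm x \<le> M + norm z" using supp supp' norm_ge_zero[of z] by (meson add_increasing2 order_refl order_trans)
  qed
  have int_e: "integrable lborel (\<lambda>x. (v (x + z) * \<eta> (x + z) - v x * \<eta> x)\<^sup>2)" for z
  proof (rule integrable_continuous_bounded_support[where M = "M + norm z"])
    show "continuous_on UNIV (\<lambda>x. (v (x + z) * \<eta> (x + z) - v x * \<eta> x)\<^sup>2)"
      by (intro continuous_intros cont)
    fix x assume "(v (x + z) * \<eta> (x + z) - v x * \<eta> x)\<^sup>2 \<noteq> 0"
    then have "\<eta> (x + z) \<noteq> 0 \<or> \<eta> x \<noteq> 0" by auto
    then show "norm x \<le> M + norm z" using supp supp' norm_ge_zero[of z] by (meson add_increasing2 order_refl order_trans)
  qed
  \<comment> \<open>Summation by parts in \<open>x\<close> for a fixed jump: the backward increment is translated into a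
    forward one, and the algebraic identity separates the energy \<open>e\<close> from the cutoff error \<open>b\<close>.\<close>
  have by_parts: "(\<integral>x. \<phi> x * second_diff v x z \<partial>lborel) = b z - e z" for z
  proof -
    have i1: "integrable lborel (\<lambda>x. \<phi> x * (v (x + z) - v x))"
      by (rule integrable_continuous_bounded_support[where M = M])
        (use phi_supp in \<open>auto intro!: continuous_intros phi_c cont\<close>)
    have i2: "integrable lborel (\<lambda>x. \<phi> x * (v (x - z) - v x))"
      by (rule integrable_continuous_bounded_support[where M = M])
        (use phi_supp in \<open>auto intro!: continuous_intros phi_c cont\<close>)
    have "(\<integral>x. \<phi> x * (v (x - z) - v x) \<partial>lborel)
        = (\<integral>x. (\<lambda>y. \<phi> y * (v (y - z) - v y)) (x + z) \<partial>lborel)"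
      by (rule integral_lborel_shift[symmetric]) measurable
    then have s2: "(\<integral>x. \<phi> x * (v (x - z) - v x) \<partial>lborel) = (\<integral>x. \<phi> (x + z) * (v x - v (x + z)) \<partial>lborel)"
      by simp
    have i2': "integrable lborel (\<lambda>x. \<phi> (x + z) * (v x - v (x + z)))"
      using integrable_lborel_shift[OF i2, of z] by simp
    have "(\<integral>x. \<phi> x * second_diff v x z \<partial>lborel)
       = (\<integral>x. \<phi> x * (v (x + z) - v x) + \<phi> x * (v (x - z) - v x) \<partial>lborel)"
      by (simp add: second_diff_def algebra_simps)
    also have "\<dots> = (\<integral>x. \<phi> x * (v (x + z) - v x) \<partial>lborel) + (\<integral>x. \<phi> (x + z) * (v x - v (x + z)) \<partial>lborel)"
      using i1 i2 s2 by simp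
    also have "\<dots> = (\<integral>x. \<phi> x * (v (x + z) - v x) + \<phi> (x + z) * (v x - v (x + z)) \<partial>lborel)"
      using i1 i2' by simp
    also have "\<dots> = (\<integral>x. v x * v (x + z) * (\<eta> (x + z) - \<eta> x)\<^sup>2
        - (v (x + z) * \<eta> (x + z) - v x * \<eta> x)\<^sup>2 \<partial>lborel)"
      by (rule Bochner_Integration.integral_cong) (auto simp: \<phi>_def power2_eq_square algebra_simps)
    also have "\<dots> = b z - e z"
      using int_b[of z] int_e[of z] unfolding b_def e_def \<eta>_def[symmetric] by simp
    finally show ?thesis .
  qed
  \<comment> \<open>Fubini is applied to the difference \<open>b - e\<close>, which is dominated; integrability of \<open>e\<close> alone
    then follows from that of \<open>b\<close>.\<close>
  obtain C where C: "C \<ge> 0" "\<And>x z. norm x \<le> M \<Longrightarrow> \<bar>second_diff v x z\<bar> \<le> C * jump_weight \<kappa> 1 z"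
    using tame_second_diff_bound[OF vt kappa_nonneg] by blast
  have prod: "integrable (lborel \<Otimes>\<^sub>M \<nu>) (\<lambda>(x, z). \<phi> x * second_diff v x z)"
  proof (rule LN.integrable_dominated_by_product)
    show "(\<lambda>(x, z). \<phi> x * second_diff v x z) \<in> borel_measurable (lborel \<Otimes>\<^sub>M \<nu>)"
      unfolding second_diff_def by measurable
    show "integrable lborel (\<lambda>x. \<bar>\<phi> x\<bar>)" by (rule phi_int)
    show "integrable \<nu> (\<lambda>z. C * jump_weight \<kappa> 1 z)" using integrable_jump_weight[of 1] by simp
    fix x z
    show "\<bar>\<phi> x * second_diff v x z\<bar> \<le> \<bar>\<phi> x\<bar> * (C * jump_weight \<kappa> 1 z)"
      using phi_supp[of x] C(2)[of x z] by (cases "\<phi> x = 0") (auto simp: abs_mult intro!: mult_left_mono)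
  qed
  have int_be: "integrable \<nu> (\<lambda>z. b z - e z)"
    using LN.integrable_snd[OF prod] by (simp add: by_parts)
  have "(\<integral>z. b z - e z \<partial>\<nu>) = (\<integral>x. (\<integral>z. \<phi> x * second_diff v x z \<partial>\<nu>) \<partial>lborel)"
    using LN.Fubini_integral[OF prod] by (simp add: by_parts)
  also have "\<dots> = 0"
    using op by (simp add: levy_op_def)
  finally have zero: "(\<integral>z. b z - e z \<partial>\<nu>) = 0" .
  have b_meas: "b \<in> borel_measurable \<nu>"
    unfolding b_def by measurable
  have b_bound: "\<bar>b z\<bar> \<le> 2 * B * p\<^sup>2 * jump_weight \<kappa> R z" for z
  proof -
    let ?m = "min 1 ((norm z / R)\<^sup>2)"
    define t where "t = (1 + norm z / R) powr \<kappa>"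
    let ?I = "\<lambda>x. indicator (ball c (2 * r)) x :: real"
    have j1: "integrable lborel (\<lambda>x. ?I x * (\<bar>v x\<bar> * \<bar>v (x + z)\<bar>))"
      by (intro integrable_indicator_ball continuous_intros cont)
    have j2: "integrable lborel (\<lambda>x. ?I x * (\<bar>v x\<bar> * \<bar>v (x + - z)\<bar>))"
      by (intro integrable_indicator_ball continuous_intros cont)
    have j2': "integrable lborel (\<lambda>x. ?I (x + z) * (\<bar>v x\<bar> * \<bar>v (x + z)\<bar>))"
      using integrable_lborel_shift[OF j2, of z] by (simp add: mult.commute)
    have "(\<integral>x. ?I x * (\<bar>v x\<bar> * \<bar>v (x + - z)\<bar>) \<partial>lborel)
        = (\<integral>x. (\<lambda>y. ?I y * (\<bar>v y\<bar> * \<bar>v (y + - z)\<bar>)) (x + z) \<partial>lborel)"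
      by (rule integral_lborel_shift[symmetric]) measurable
    then have s2: "(\<integral>x. ?I (x + z) * (\<bar>v x\<bar> * \<bar>v (x + z)\<bar>) \<partial>lborel) = (\<integral>x. ?I x * (\<bar>v x\<bar> * \<bar>v (x + - z)\<bar>) \<partial>lborel)"
      by (simp add: mult.commute)
    have "\<bar>b z\<bar> \<le> (\<integral>x. \<bar>v x * v (x + z) * (\<eta> (x + z) - \<eta> x)\<^sup>2\<bar> \<partial>lborel)"
      unfolding b_def by (rule integral_abs_bound)
    also have "\<dots> \<le> (\<integral>x. ?m * (?I x * (\<bar>v x\<bar> * \<bar>v (x + z)\<bar>) + ?I (x + z) * (\<bar>v x\<bar> * \<bar>v (x + z)\<bar>)) \<partial>lborel)"
    proof (rule integral_mono)
      show "integrable lborel (\<lambda>x. \<bar>v x * v (x + z) * (\<eta> (x + z) - \<eta> x)\<^sup>2\<bar>)"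
        using int_b[of z] by simp
      show "integrable lborel (\<lambda>x. ?m * (?I x * (\<bar>v x\<bar> * \<bar>v (x + z)\<bar>) + ?I (x + z) * (\<bar>v x\<bar> * \<bar>v (x + z)\<bar>)))"
        using j1 j2' by simp
      fix x
      have "\<bar>v x * v (x + z) * (\<eta> (x + z) - \<eta> x)\<^sup>2\<bar> = (\<bar>v x\<bar> * \<bar>v (x + z)\<bar>) * (\<eta> (x + z) - \<eta> x)\<^sup>2"
        by (simp add: abs_mult)
      also have "\<dots> \<le> (\<bar>v x\<bar> * \<bar>v (x + z)\<bar>) * (?m * (?I x + ?I (x + z)))"
        unfolding \<eta>_def by (intro mult_left_mono cutoff_diff R) auto
      finally show "\<bar>v x * v (x + z) * (\<eta> (x + z) - \<eta> x)\<^sup>2\<bar>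
          \<le> ?m * (?I x * (\<bar>v x\<bar> * \<bar>v (x + z)\<bar>) + ?I (x + z) * (\<bar>v x\<bar> * \<bar>v (x + z)\<bar>))"
        by (simp only: algebra_simps)
    qed
    also have "\<dots> = ?m * ((\<integral>x. ?I x * (\<bar>v x\<bar> * \<bar>v (x + z)\<bar>) \<partial>lborel) + (\<integral>x. ?I x * (\<bar>v x\<bar> * \<bar>v (x + - z)\<bar>) \<partial>lborel))"
      using j1 j2' s2 by simp
    also have "\<dots> \<le> ?m * (B * p\<^sup>2 * t + B * p\<^sup>2 * t)"
      using cross_term_bound[OF vc R(1) mass, of c z] cross_term_bound[OF vc R(1) mass, of c "- z"]
      unfolding t_def p_def by (intro mult_left_mono add_mono) auto
    also have "\<dots> = 2 * B * p\<^sup>2 * jump_weight \<kappa> R z"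
      unfolding jump_weight_def t_def by (simp add: algebra_simps)
    finally show ?thesis .
  qed
  have int_jw: "integrable \<nu> (\<lambda>z. 2 * B * p\<^sup>2 * jump_weight \<kappa> R z)"
    using integrable_jump_weight[OF R(1)] by simp
  have int_bn: "integrable \<nu> b"
    by (rule Bochner_Integration.integrable_bound[OF int_jw b_meas], rule AE_I2)
      (simp add: order_trans[OF b_bound abs_ge_self])
  have "integrable \<nu> (\<lambda>z. b z - (b z - e z))"
    using int_bn int_be by (rule Bochner_Integration.integrable_diff)
  then show int_en: "integrable \<nu> e" by simp
  have "(\<integral>z. e z \<partial>\<nu>) = (\<integral>z. b z \<partial>\<nu>)" using zero int_bn int_en by simp
  also have "\<dots> \<le> (\<integral>z. 2 * B * p\<^sup>2 * jump_weight \<kappa> R z \<partial>\<nu>)"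
    by (rule integral_mono[OF int_bn int_jw]) (use b_bound abs_ge_self order_trans in blast)
  also have "\<dots> = 2 * B * p\<^sup>2 * (\<integral>z. jump_weight \<kappa> R z \<partial>\<nu>)" by simp
  also have "\<dots> \<le> 2 * B * p\<^sup>2 * (J * R powr (- 2 * s))"
  proof (intro mult_left_mono jump_weight_scaling R)
    have "0 \<le> local_mass v c (2 * r)" unfolding local_mass_def by (simp add: integral_nonneg_AE)
    then show "0 \<le> 2 * B * p\<^sup>2" using mass[of c] unfolding p_def by linarith
  qed
  finally show "(\<integral>z. e z \<partial>\<nu>) \<le> 2 * B * ((R + norm c) powr \<kappa>)\<^sup>2 * (J * R powr (- 2 * s))"
    unfolding p_def .
qed

end

section \<open>Averaged increments preserve harmonicity and lose mass\<close>

context levy_scaling begin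

lemma integrable_near_weight_mult:
  assumes h: "h \<in> borel_measurable borel" and bound: "\<And>z. norm z \<le> 1 \<Longrightarrow> \<bar>h z\<bar> \<le> C"
  shows "integrable \<nu> (\<lambda>z. near_weight z * h z)"
proof -
  note h[measurable]
  have "integrable \<nu> (\<lambda>z. near_weight z * C)" using integrable_near_weight by simp
  then show ?thesis
    by (rule Bochner_Integration.integrable_bound, measurable, intro AE_I2)
      (simp add: order_trans[OF near_weight_mult_bound[of h C, OF bound] abs_ge_self])
qed

lemma integral_near_weight_le:
  assumes "integrable \<nu> (\<lambda>z. near_weight z * h z)" and bound: "\<And>z. norm z \<le> 1 \<Longrightarrow> \<bar>h z\<bar> \<le> C"
  shows "\<bar>\<integral>z. near_weight z * h z \<partial>\<nu>\<bar> \<le> (\<integral>z. near_weight z \<partial>\<nu>) * C"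
proof -
  have "\<bar>\<integral>z. near_weight z * h z \<partial>\<nu>\<bar> \<le> (\<integral>z. \<bar>near_weight z * h z\<bar> \<partial>\<nu>)"
    by (rule integral_abs_bound)
  also have "\<dots> \<le> (\<integral>z. near_weight z * C \<partial>\<nu>)"
    by (rule integral_mono)
      (use assms(1) integrable_near_weight near_weight_mult_bound[of h C, OF bound] in auto)
  finally show ?thesis by simp
qed

lemma average_diff_integrable:
  assumes v: "tame \<kappa> v" and g: "unit_multiplier g"
  shows "integrable \<nu> (\<lambda>z. near_weight z * (g z * (v (x + z) - v x)))"
proof -
  note tame_measurable[OF v, measurable] unit_multiplierD(1)[OF g, measurable]
  obtain C where C: "C \<ge> 0" "\<And>y. norm y \<le> norm x + 1 \<Longrightarrow> \<bar>v y\<bar> \<le> C"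
    using tame_locally_bounded[OF v kappa_nonneg] by blast
  show ?thesis
  proof (rule integrable_near_weight_mult)
    fix z :: 'a assume z: "norm z \<le> 1"
    have "\<bar>v (x + z)\<bar> \<le> C" using C(2)[of "x + z"] norm_triangle_ineq[of x z] z by simp
    moreover have "\<bar>v x\<bar> \<le> C" using C(2)[of x] by simp
    ultimately have "\<bar>v (x + z) - v x\<bar> \<le> 2 * C" by linarith
    then have "\<bar>g z\<bar> * \<bar>v (x + z) - v x\<bar> \<le> 1 * (2 * C)"
      using unit_multiplierD(2)[OF g, of z] by (intro mult_mono) auto
    then show "\<bar>g z * (v (x + z) - v x)\<bar> \<le> 2 * C" by (simp add: abs_mult)
  qed measurable
qed

lemma second_diff_average_diff:
  assumes v: "tame \<kappa> v" and g: "unit_multiplier g"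
  shows "second_diff (average_diff \<nu> g v) x w
    = (\<integral>z. near_weight z * (g z * (second_diff v (x + z) w - second_diff v x w)) \<partial>\<nu>)"
proof -
  note i = average_diff_integrable[OF v g]
  have "second_diff (average_diff \<nu> g v) x w = 
    (\<integral>z. near_weight z * (g z * (v (x + w + z) - v (x + w))) + near_weight z * (g z * (v (x - w + z) - v (x - w)))
      - 2 * (near_weight z * (g z * (v (x + z) - v x))) \<partial>\<nu>)"
    unfolding second_diff_def average_diff_def using i by simp
  also have "\<dots> = (\<integral>z. near_weight z * (g z * (second_diff v (x + z) w - second_diff v x w)) \<partial>\<nu>)"
    by (rule Bochner_Integration.integral_cong) (auto simp: second_diff_def algebra_simps)
  finally show ?thesis .
qed

lemma integrable_second_diff_average:
  assumes v: "tame \<kappa> v" and g: "unit_multiplier g"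
  shows "integrable \<nu> (\<lambda>z. near_weight z * (g z * (second_diff v (x + z) w - second_diff v x w)))"
proof -
  note i = average_diff_integrable[OF v g]
  have "integrable \<nu> (\<lambda>z. near_weight z * (g z * (v (x + w + z) - v (x + w))) + near_weight z * (g z * (v (x - w + z) - v (x - w)))
      - 2 * (near_weight z * (g z * (v (x + z) - v x))))"
    using i by simp
  then show ?thesis
    by (rule Bochner_Integration.integrable_cong[THEN iffD1, rotated -1]) (auto simp: second_diff_def algebra_simps)
qed

text \<open>All three conditions survive because only jumps of length at most one, of finite total weight,
  are averaged; continuity is dominated convergence.\<close>
lemma tame_average_diff:
  assumes v: "tame \<kappa> v" and g: "unit_multiplier g"
  shows "tame \<kappa> (average_diff \<nu> g v)"
  unfolding tame_def
proof (intro conjI allI)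
  note [measurable] = tame_measurable[OF v] unit_multiplierD(1)[OF g]
  let ?N = "\<integral>z. near_weight z \<partial>\<nu>"
  have vc: "continuous_on UNIV v" using tame_cont[OF v] .
  have N: "0 \<le> ?N" by (intro integral_nonneg_AE AE_I2 near_weight_range)
  have gm: "\<bar>g z * y\<bar> \<le> \<bar>y\<bar>" for z y
    using unit_multiplierD(2)[OF g, of z] by (simp add: abs_mult mult_left_le_one_le)
  show "continuous_on UNIV (average_diff \<nu> g v)"
  proof (rule continuous_at_imp_continuous_on, rule ballI)
    fix x :: 'a
    obtain C where C: "C \<ge> 0" "\<And>y. norm y \<le> norm x + 2 \<Longrightarrow> \<bar>v y\<bar> \<le> C"
      using tame_locally_bounded[OF v kappa_nonneg] by blast
    have ae: "\<bar>near_weight z * (g z * (v (y + z) - v y))\<bar> \<le> near_weight z * (2 * C)" if y: "dist y x \<le> 1" for y z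
    proof (rule near_weight_mult_bound)
      fix z :: 'a assume z: "norm z \<le> 1"
      have ny: "norm y \<le> norm x + 1" using y norm_triangle_sub[of y x] by (simp add: dist_norm)
      have "\<bar>v (y + z)\<bar> \<le> C" "\<bar>v y\<bar> \<le> C"
        using C(2)[of "y + z"] C(2)[of y] norm_triangle_ineq[of y z] ny z by auto
      then have "\<bar>v (y + z) - v y\<bar> \<le> 2 * C" by linarith
      then show "\<bar>g z * (v (y + z) - v y)\<bar> \<le> 2 * C" using gm order_trans by blast
    qed
    show "isCont (average_diff \<nu> g v) x"
      unfolding continuous_at_sequentially comp_def
    proof (intro allI impI)
      fix X :: "nat \<Rightarrow> 'a" assume X: "X \<longlonglongrightarrow> x"
      then obtain n0 where n0: "\<And>n. n \<ge> n0 \<Longrightarrow> dist (X n) x < 1"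
        unfolding lim_sequentially by (metis zero_less_one)
      have "(\<lambda>n. average_diff \<nu> g v (X (n + n0))) \<longlonglongrightarrow> average_diff \<nu> g v x"
        unfolding average_diff_def
      proof (rule integral_dominated_convergence[where w = "\<lambda>z. near_weight z * (2 * C)"])
        have lim: "(\<lambda>n. v (X (n + n0) + z)) \<longlonglongrightarrow> v (x + z)" for z
        proof -
          have "isCont v (x + z)" using vc by (simp add: continuous_on_eq_continuous_at)
          moreover have "(\<lambda>n. X (n + n0) + z) \<longlonglongrightarrow> x + z"
            by (intro tendsto_add tendsto_const LIMSEQ_ignore_initial_segment X)
          ultimately show ?thesis by (rule isCont_tendsto_compose)
        qed
        show "AE z in \<nu>. (\<lambda>n. near_weight z * (g z * (v (X (n + n0) + z) - v (X (n + n0)))))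
            \<longlonglongrightarrow> near_weight z * (g z * (v (x + z) - v x))"
          using lim lim[of 0] by (intro AE_I2 tendsto_intros) auto
        show "AE z in \<nu>. norm (near_weight z * (g z * (v (X (n + n0) + z) - v (X (n + n0))))) \<le> near_weight z * (2 * C)" for n
          using ae[of "X (n + n0)"] n0[of "n + n0"] by (intro AE_I2) auto
        show "integrable \<nu> (\<lambda>z. near_weight z * (2 * C))" using integrable_near_weight by simp
      qed measurable
      then show "(\<lambda>n. average_diff \<nu> g v (X n)) \<longlonglongrightarrow> average_diff \<nu> g v x"
        by (rule LIMSEQ_offset)
    qed
  qed
  show "\<exists>B. \<forall>x. \<bar>average_diff \<nu> g v x\<bar> \<le> B * (1 + norm x) powr \<kappa>"
  proof -
    obtain B where B: "B \<ge> 0" "\<And>x. \<bar>v x\<bar> \<le> B * (1 + norm x) powr \<kappa>"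
      using tame_growth[OF v] by blast
    have "\<bar>average_diff \<nu> g v x\<bar> \<le> (?N * (2 * B * 2 powr \<kappa>)) * (1 + norm x) powr \<kappa>" for x
    proof -
      have "\<bar>average_diff \<nu> g v x\<bar> \<le> ?N * (2 * B * 2 powr \<kappa> * (1 + norm x) powr \<kappa>)"
        unfolding average_diff_def
      proof (rule integral_near_weight_le[OF average_diff_integrable[OF v g]])
        fix z :: 'a assume z: "norm z \<le> 1"
        have *: "\<bar>v y\<bar> \<le> B * (2 powr \<kappa> * (1 + norm x) powr \<kappa>)" if "norm y \<le> norm x + 1" for y
        proof -
          have "(1 + norm y) powr \<kappa> \<le> 2 powr \<kappa> * (1 + norm x) powr \<kappa>"
            unfolding powr_mult[symmetric]
          proof (intro powr_mono2 kappa_nonneg)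
            show "1 + norm y \<le> 2 * (1 + norm x)" using that norm_ge_zero[of x] by argo
          qed auto
          then have "B * (1 + norm y) powr \<kappa> \<le> B * (2 powr \<kappa> * (1 + norm x) powr \<kappa>)"
            using B(1) by (intro mult_left_mono)
          then show ?thesis using B(2)[of y] by linarith
        qed
        have "\<bar>v (x + z) - v x\<bar> \<le> 2 * (B * (2 powr \<kappa> * (1 + norm x) powr \<kappa>))"
          using *[of "x + z"] *[of x] norm_triangle_ineq[of x z] z by linarith
        then show "\<bar>g z * (v (x + z) - v x)\<bar> \<le> 2 * B * 2 powr \<kappa> * (1 + norm x) powr \<kappa>"
          using gm[of z "v (x + z) - v x"] by (simp add: mult.assoc)
      qed
      then show ?thesis by (simp add: mult.assoc)
    qed
    then show ?thesis by blast
  qed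
  show "\<exists>B. \<forall>x w. norm x \<le> M \<longrightarrow> norm w \<le> 1 \<longrightarrow> \<bar>second_diff (average_diff \<nu> g v) x w\<bar> \<le> B * (norm w)\<^sup>2" for M
  proof -
    obtain D where D: "\<And>x z. norm x \<le> M + 1 \<Longrightarrow> norm z \<le> 1 \<Longrightarrow> \<bar>second_diff v x z\<bar> \<le> D * (norm z)\<^sup>2"
      using v unfolding tame_def by blast
    have "\<bar>second_diff (average_diff \<nu> g v) x w\<bar> \<le> (?N * (2 * D)) * (norm w)\<^sup>2"
      if x: "norm x \<le> M" and w: "norm w \<le> 1" for x w
    proof -
      have "\<bar>second_diff (average_diff \<nu> g v) x w\<bar> \<le> ?N * (2 * D * (norm w)\<^sup>2)"
        unfolding second_diff_average_diff[OF v g]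
      proof (rule integral_near_weight_le[OF integrable_second_diff_average[OF v g]])
        fix z :: 'a assume z: "norm z \<le> 1"
        have "\<bar>second_diff v (x + z) w\<bar> \<le> D * (norm w)\<^sup>2" "\<bar>second_diff v x w\<bar> \<le> D * (norm w)\<^sup>2"
          using norm_triangle_ineq[of x z] x w z by (auto intro!: D)
        then show "\<bar>g z * (second_diff v (x + z) w - second_diff v x w)\<bar> \<le> 2 * D * (norm w)\<^sup>2"
          using gm[of z "second_diff v (x + z) w - second_diff v x w"] by linarith
      qed
      then show ?thesis by (simp add: mult.assoc)
    qed
    then show ?thesis by blast
  qed
qed

text \<open>The operator commutes with translations, hence with averages of translates: exchange the two
  integrals over \<open>\<nu>\<close>.\<close>
lemma harmonic_average_diff:
  assumes v: "harmonic v" and g: "unit_multiplier g"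
  shows "harmonic (average_diff \<nu> g v)"
  unfolding harmonic_def
proof (intro conjI allI)
  have vt: "tame \<kappa> v" and op: "\<And>x. levy_op \<nu> v x = 0" using v by (auto simp: harmonic_def)
  show "tame \<kappa> (average_diff \<nu> g v)" by (rule tame_average_diff[OF vt g])
  fix x :: 'a
  note [measurable] = tame_measurable[OF vt] unit_multiplierD(1)[OF g]
  obtain C where C: "C \<ge> 0" "\<And>y z. norm y \<le> norm x + 1 \<Longrightarrow> \<bar>second_diff v y z\<bar> \<le> C * jump_weight \<kappa> 1 z"
    using tame_second_diff_bound[OF vt kappa_nonneg] by blast
  have prod: "integrable (\<nu> \<Otimes>\<^sub>M \<nu>) (\<lambda>(z, w). near_weight z * (g z * (second_diff v (x + z) w - second_diff v x w)))"
  proof (rule NN.integrable_dominated_by_product)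
    show "(\<lambda>(z, w). near_weight z * (g z * (second_diff v (x + z) w - second_diff v x w))) \<in> borel_measurable (\<nu> \<Otimes>\<^sub>M \<nu>)"
      unfolding second_diff_def by measurable
    show "integrable \<nu> near_weight" by (rule integrable_near_weight)
    show "integrable \<nu> (\<lambda>w. 2 * C * jump_weight \<kappa> 1 w)" using integrable_jump_weight[of 1] by simp
    fix z w
    show "\<bar>near_weight z * (g z * (second_diff v (x + z) w - second_diff v x w))\<bar> \<le> near_weight z * (2 * C * jump_weight \<kappa> 1 w)"
    proof (rule near_weight_mult_bound)
      fix z :: 'a assume z: "norm z \<le> 1"
      have "\<bar>second_diff v (x + z) w\<bar> \<le> C * jump_weight \<kappa> 1 w" "\<bar>second_diff v x w\<bar> \<le> C * jump_weight \<kappa> 1 w"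
        using norm_triangle_ineq[of x z] z by (auto intro!: C)
      then have "\<bar>second_diff v (x + z) w - second_diff v x w\<bar> \<le> 2 * C * jump_weight \<kappa> 1 w" by linarith
      then have "\<bar>g z\<bar> * \<bar>second_diff v (x + z) w - second_diff v x w\<bar> \<le> 1 * (2 * C * jump_weight \<kappa> 1 w)"
        using unit_multiplierD(2)[OF g, of z] by (intro mult_mono) auto
      then show "\<bar>g z * (second_diff v (x + z) w - second_diff v x w)\<bar> \<le> 2 * C * jump_weight \<kappa> 1 w"
        by (simp add: abs_mult)
    qed
  qed
  have "levy_op \<nu> (average_diff \<nu> g v) x
    = (\<integral>z. \<integral>w. near_weight z * (g z * (second_diff v (x + z) w - second_diff v x w)) \<partial>\<nu> \<partial>\<nu>)"
    unfolding levy_op_def second_diff_average_diff[OF vt g] by (rule NN.Fubini_integral[OF prod])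
  also have "\<dots> = (\<integral>z. near_weight z * (g z * (levy_op \<nu> v (x + z) - levy_op \<nu> v x)) \<partial>\<nu>)"
    unfolding levy_op_def using integrable_second_diff[OF vt] by simp
  finally show "levy_op \<nu> (average_diff \<nu> g v) x = 0" using op by simp
qed

text \<open>The constant of the next lemma; it is independent of the scale, the function and the averaging
  density, so it may be raised to the power of the number of iterations.\<close>
definition gain :: real where
  "gain = (1 + (\<integral>z. near_weight z \<partial>\<nu>)) * ((6 + 2 * 2 powr \<kappa>) * J)"

text \<open>By the Cauchy-Schwarz inequality the squared average is at most an average of squared increments.
  Inside the ball the cutoff is one, so the increment of \<open>v\<close> differs from that of \<open>v \<eta>\<close> only by
  \<open>v' * (\<eta>' - \<eta>)\<close>; the first part is the energy and the second is small because \<open>\<eta>\<close> varies on the scale \<open>r\<close>. The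
  radius is halved in each step, which the iteration can afford because the number of steps is fixed.\<close>
lemma local_mass_average_diff:
  assumes v: "harmonic v" and g: "unit_multiplier g" and R: "1 \<le> R" "R \<le> r"
    and mass: "\<And>c. local_mass v c (2 * r) \<le> B * ((R + norm c) powr \<kappa>)\<^sup>2"
  shows "local_mass (average_diff \<nu> g v) c r \<le> (gain * R powr (- 2 * s) * B) * ((R + norm c) powr \<kappa>)\<^sup>2"
proof -
  have vt: "tame \<kappa> v" using v by (simp add: harmonic_def)
  have vc: "continuous_on UNIV v" using tame_cont[OF vt] .
  note [measurable] = tame_measurable[OF vt] unit_multiplierD(1)[OF g]
  have r: "0 < r" using R by simp
  define p where "p = (R + norm c) powr \<kappa>"
  define N where "N = (\<integral>z. near_weight z \<partial>\<nu>)"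
  define e where "e z = (\<integral>x. (v (x + z) * cutoff c r (x + z) - v x * cutoff c r x)\<^sup>2 \<partial>lborel)" for z
  define h where "h z = (\<integral>x. indicator (ball c r) x * (v (x + z) - v x)\<^sup>2 \<partial>lborel)" for z
  have N: "0 \<le> N" unfolding N_def by (intro integral_nonneg_AE AE_I2 near_weight_range)
  have e_int: "integrable \<nu> e" and e_le: "(\<integral>z. e z \<partial>\<nu>) \<le> 2 * B * p\<^sup>2 * (J * R powr (- 2 * s))"
    unfolding e_def p_def using energy_bound[OF v R mass, of c] by auto
  have Bp: "0 \<le> B * p\<^sup>2"
  proof -
    have "0 \<le> local_mass v c (2 * r)" unfolding local_mass_def by (simp add: integral_nonneg_AE)
    then show ?thesis using mass[of c] unfolding p_def by linarith
  qed
  have hc: "continuous_on UNIV (cutoff c r)" by (rule cutoff_continuous[OF r])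
  have shiftc: "continuous_on UNIV (\<lambda>x. f (x + z))" if "continuous_on UNIV f" for f :: "'a \<Rightarrow> real" and z
    by (intro continuous_on_compose2[OF that] continuous_intros) auto
  note cont = vc hc shiftc[OF vc] shiftc[OF hc]
  obtain C where C: "C \<ge> 0" "\<And>y. norm y \<le> norm c + r + 1 \<Longrightarrow> \<bar>v y\<bar> \<le> C"
    using tame_locally_bounded[OF vt kappa_nonneg] by blast
  have D: "\<bar>v (x + z) - v x\<bar> \<le> 2 * C" if x: "x \<in> ball c r" and z: "norm z \<le> 1" for x z
  proof -
    have "norm x \<le> norm c + r" using x norm_triangle_sub[of x c] by (simp add: dist_norm norm_minus_commute)
    then have "\<bar>v (x + z)\<bar> \<le> C" "\<bar>v x\<bar> \<le> C"
      using C(2)[of "x + z"] C(2)[of x] norm_triangle_ineq[of x z] z by auto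
    then show ?thesis by linarith
  qed
  have prod: "integrable (lborel \<Otimes>\<^sub>M \<nu>) (\<lambda>(x, z). indicator (ball c r) x * (near_weight z * (v (x + z) - v x)\<^sup>2))"
  proof (rule LN.integrable_dominated_by_product)
    show "(\<lambda>(x, z). indicator (ball c r) x * (near_weight z * (v (x + z) - v x)\<^sup>2)) \<in> borel_measurable (lborel \<Otimes>\<^sub>M \<nu>)"
      by measurable
    show "integrable lborel (\<lambda>x::'a. indicator (ball c r) x * (2 * C)\<^sup>2)"
      by (intro integrable_indicator_ball continuous_intros)
    show "integrable \<nu> near_weight" by (rule integrable_near_weight)
    fix x z
    show "\<bar>indicator (ball c r) x * (near_weight z * (v (x + z) - v x)\<^sup>2)\<bar> \<le> indicator (ball c r) x * (2 * C)\<^sup>2 * near_weight z"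
    proof (cases "x \<in> ball c r")
      case True
      have "\<bar>near_weight z * (v (x + z) - v x)\<^sup>2\<bar> \<le> near_weight z * (2 * C)\<^sup>2"
      proof (rule near_weight_mult_bound)
        fix z :: 'a assume "norm z \<le> 1"
        from power_mono[OF D[OF True this], of 2] show "\<bar>(v (x + z) - v x)\<^sup>2\<bar> \<le> (2 * C)\<^sup>2"
          by simp
      qed
      with True show ?thesis by (simp add: mult.commute)
    qed simp
  qed
  have int_h: "integrable \<nu> (\<lambda>z. near_weight z * h z)"
    using LN.integrable_snd[OF prod] by (simp add: h_def mult.left_commute)
  have swap: "(\<integral>x. indicator (ball c r) x * (\<integral>z. near_weight z * (v (x + z) - v x)\<^sup>2 \<partial>\<nu>) \<partial>lborel)
      = (\<integral>z. near_weight z * h z \<partial>\<nu>)"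
    using LN.Fubini_integral[OF prod] unfolding h_def
    by (simp only: mult.left_commute[of "near_weight _"] integral_mult_right_zero[symmetric] mult.assoc)
  have int_x: "integrable lborel (\<lambda>x. indicator (ball c r) x * (\<integral>z. near_weight z * (v (x + z) - v x)\<^sup>2 \<partial>\<nu>))"
    using LN.integrable_fst[OF prod] by simp
  have point: "indicator (ball c r) x * (average_diff \<nu> g v x)\<^sup>2
      \<le> (1 + N) * (indicator (ball c r) x * (\<integral>z. near_weight z * (v (x + z) - v x)\<^sup>2 \<partial>\<nu>))" for x
  proof (cases "x \<in> ball c r")
    case True
    have gsq: "(g z * (v (x + z) - v x))\<^sup>2 \<le> (v (x + z) - v x)\<^sup>2" for z
      using unit_multiplierD(2)[OF g, of z]
      by (simp add: abs_le_square_iff[symmetric] abs_mult mult_left_le_one_le)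
    have dsq: "(v (x + z) - v x)\<^sup>2 \<le> (2 * C)\<^sup>2" if "norm z \<le> 1" for z
      using power_mono[OF D[OF True that], of 2] by simp
    have i2: "integrable \<nu> (\<lambda>z. near_weight z * (g z * (v (x + z) - v x))\<^sup>2)"
      by (rule integrable_near_weight_mult[where C = "(2 * C)\<^sup>2"]) (use order_trans[OF gsq dsq] in auto)
    have i3: "integrable \<nu> (\<lambda>z. near_weight z * (v (x + z) - v x)\<^sup>2)"
      by (rule integrable_near_weight_mult[where C = "(2 * C)\<^sup>2"]) (use dsq in auto)
    have "(average_diff \<nu> g v x)\<^sup>2 \<le> (1 + N) * (\<integral>z. near_weight z * (g z * (v (x + z) - v x))\<^sup>2 \<partial>\<nu>)"
      unfolding average_diff_def N_def
      by (rule weighted_cauchy_schwarz[OF integrable_near_weight near_weight_range(1) average_diff_integrable[OF vt g] i2])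
    also have "\<dots> \<le> (1 + N) * (\<integral>z. near_weight z * (v (x + z) - v x)\<^sup>2 \<partial>\<nu>)"
      using N i2 i3 gsq near_weight_range by (intro mult_left_mono integral_mono) auto
    finally show ?thesis using True by simp
  qed simp
  have "local_mass (average_diff \<nu> g v) c r
      \<le> (\<integral>x. (1 + N) * (indicator (ball c r) x * (\<integral>z. near_weight z * (v (x + z) - v x)\<^sup>2 \<partial>\<nu>)) \<partial>lborel)"
    unfolding local_mass_def
  proof (rule integral_mono[OF _ _ point])
    show "integrable lborel (\<lambda>x. indicator (ball c r) x * (average_diff \<nu> g v x)\<^sup>2)"
      by (intro integrable_indicator_ball continuous_intros tame_cont[OF tame_average_diff[OF vt g]])
    show "integrable lborel (\<lambda>x. (1 + N) * (indicator (ball c r) x * (\<integral>z. near_weight z * (v (x + z) - v x)\<^sup>2 \<partial>\<nu>)))"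
      using int_x by (rule integrable_mult_right)
  qed
  also have "\<dots> = (1 + N) * (\<integral>z. near_weight z * h z \<partial>\<nu>)"
    by (simp only: integral_mult_right_zero swap)
  finally have main: "local_mass (average_diff \<nu> g v) c r \<le> (1 + N) * (\<integral>z. near_weight z * h z \<partial>\<nu>)" .
  define T where "T = 2 * (B * p\<^sup>2) * (1 + 2 powr \<kappa>)"
  have T0: "0 \<le> T"
    unfolding T_def by (intro mult_nonneg_nonneg[OF mult_nonneg_nonneg[OF _ Bp]] add_nonneg_nonneg) auto
  \<comment> \<open>The error term carries the factor \<open>t\<^sup>2\<close>; as only jumps of length at most one occur, one factor
    \<open>t\<close> is replaced by the constant \<open>2 powr \<kappa>\<close> and \<open>jump_weight\<close> reappears.\<close>
  have h_le: "near_weight z * h z \<le> 2 * e z + T * jump_weight \<kappa> R z" for z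
  proof (cases "norm z \<le> 1")
    case False
    have "0 \<le> e z" unfolding e_def by (simp add: integral_nonneg_AE)
    moreover have "0 \<le> T * jump_weight \<kappa> R z"
      by (intro mult_nonneg_nonneg jump_weight_nonneg T0)
    ultimately show ?thesis using False by (simp add: near_weight_def)
  next
    case True
    let ?m = "min 1 ((norm z / R)\<^sup>2)"
    let ?I = "\<lambda>x. indicator (ball c (2 * r)) x :: real"
    define t where "t = (1 + norm z / R) powr \<kappa>"
    have t1: "1 \<le> t" unfolding t_def using R kappa_nonneg by (simp add: ge_one_powr_ge_zero)
    have t2: "t \<le> 2 powr \<kappa>"
      unfolding t_def using True R kappa_nonneg by (intro powr_mono2) (auto simp: field_simps)
    have ie: "integrable lborel (\<lambda>x. (v (x + z) * cutoff c r (x + z) - v x * cutoff c r x)\<^sup>2)"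
    proof (rule integrable_continuous_bounded_support[where M = "norm c + 2 * r + norm z"])
      show "continuous_on UNIV (\<lambda>x. (v (x + z) * cutoff c r (x + z) - v x * cutoff c r x)\<^sup>2)"
        by (intro continuous_intros cont)
      fix x assume "(v (x + z) * cutoff c r (x + z) - v x * cutoff c r x)\<^sup>2 \<noteq> 0"
      then have "cutoff c r (x + z) \<noteq> 0 \<or> cutoff c r x \<noteq> 0" by auto
      then have "x + z \<in> ball c (2 * r) \<or> x \<in> ball c (2 * r)" using cutoff_support[OF r] by blast
      then have "norm (x + z - c) \<le> 2 * r \<or> norm (x - c) \<le> 2 * r"
        by (auto simp: dist_norm norm_minus_commute)
      then show "norm x \<le> norm c + 2 * r + norm z"
        using norm_triangle_sub[of "x + z" c] norm_triangle_sub[of x c] norm_triangle_ineq4[of "x + z" z] norm_ge_zero[of z]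
          add_diff_cancel_right'[of x z]
        by (elim disjE) (simp only:, linarith)+
    qed
    have j1: "integrable lborel (\<lambda>x. ?I x * (v (x + z))\<^sup>2)"
      by (intro integrable_indicator_ball continuous_intros cont)
    have j2: "integrable lborel (\<lambda>x. ?I x * (v x)\<^sup>2)"
      by (intro integrable_indicator_ball continuous_intros cont)
    have j2': "integrable lborel (\<lambda>x. ?I (x + z) * (v (x + z))\<^sup>2)"
      using integrable_lborel_shift[OF j2, of z] by simp
    have s2: "(\<integral>x. ?I (x + z) * (v (x + z))\<^sup>2 \<partial>lborel) = local_mass v c (2 * r)"
      unfolding local_mass_def
      by (rule integral_lborel_shift[where f = "\<lambda>y. ?I y * (v y)\<^sup>2"]) measurable
    have ih: "integrable lborel (\<lambda>x. indicator (ball c r) x * (v (x + z) - v x)\<^sup>2)"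
      by (intro integrable_indicator_ball continuous_intros cont)
    have "h z \<le> (\<integral>x. 2 * (v (x + z) * cutoff c r (x + z) - v x * cutoff c r x)\<^sup>2
        + 2 * (?m * (?I x * (v (x + z))\<^sup>2 + ?I (x + z) * (v (x + z))\<^sup>2)) \<partial>lborel)"
      unfolding h_def
    proof (rule integral_mono[OF ih])
      show "integrable lborel (\<lambda>x. 2 * (v (x + z) * cutoff c r (x + z) - v x * cutoff c r x)\<^sup>2
        + 2 * (?m * (?I x * (v (x + z))\<^sup>2 + ?I (x + z) * (v (x + z))\<^sup>2)))"
        using ie j1 j2' by simp
      fix x
      define a where "a = v (x + z) * cutoff c r (x + z) - v x * cutoff c r x"
      define d where "d = cutoff c r (x + z) - cutoff c r x"
      have "(v (x + z))\<^sup>2 * d\<^sup>2 \<le> (v (x + z))\<^sup>2 * (?m * (?I x + ?I (x + z)))"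
        unfolding d_def by (intro mult_left_mono cutoff_diff R) auto
      then have dd: "(v (x + z) * d)\<^sup>2 \<le> ?m * (?I x * (v (x + z))\<^sup>2 + ?I (x + z) * (v (x + z))\<^sup>2)"
        by (simp only: power_mult_distrib algebra_simps)
      show "indicator (ball c r) x * (v (x + z) - v x)\<^sup>2 \<le> 2 * (v (x + z) * cutoff c r (x + z) - v x * cutoff c r x)\<^sup>2
        + 2 * (?m * (?I x * (v (x + z))\<^sup>2 + ?I (x + z) * (v (x + z))\<^sup>2))"
      proof (cases "x \<in> ball c r")
        case True
        have "v (x + z) - v x = a - v (x + z) * d"
          unfolding a_def d_def using cutoff_inner[OF r True] by (simp add: algebra_simps)
        then have "(v (x + z) - v x)\<^sup>2 = (a - v (x + z) * d)\<^sup>2" by simp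
        also have "\<dots> \<le> 2 * a\<^sup>2 + 2 * (v (x + z) * d)\<^sup>2"
        proof -
          have "0 \<le> (a + v (x + z) * d)\<^sup>2" by simp
          then show ?thesis by (simp add: power2_eq_square algebra_simps)
        qed
        finally have "(v (x + z) - v x)\<^sup>2 \<le> 2 * a\<^sup>2 + 2 * (v (x + z) * d)\<^sup>2" .
        then show ?thesis using dd True unfolding a_def by simp
      next
        case False
        have "0 \<le> (v (x + z) * d)\<^sup>2" by simp
        then show ?thesis using dd False by simp
      qed
    qed
    also have "\<dots> = 2 * e z + 2 * (?m * (local_mass v (c + z) (2 * r) + local_mass v c (2 * r)))"
      unfolding e_def local_mass_shift[OF vc, symmetric] s2[symmetric]
      using ie j1 j2' by simp
    also have "\<dots> \<le> 2 * e z + 2 * (?m * (B * p\<^sup>2 * (t * (1 + 2 powr \<kappa>))))"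
    proof -
      have B: "0 \<le> B"
      proof -
        have "0 < p" unfolding p_def using R norm_ge_zero[of c] by (simp only: powr_gt_zero)
        then show ?thesis using Bp by (simp add: zero_le_mult_iff)
      qed
      have "local_mass v (c + z) (2 * r) \<le> B * ((R + norm (c + z)) powr \<kappa>)\<^sup>2" by (rule mass)
      also have "\<dots> \<le> B * (p * t)\<^sup>2"
        unfolding p_def t_def using B weight_shift[OF R(1) kappa_nonneg, of c z]
        by (intro mult_left_mono power_mono) auto
      also have "\<dots> = B * p\<^sup>2 * (t * t)" by (simp add: power2_eq_square)
      also have "\<dots> \<le> B * p\<^sup>2 * (t * 2 powr \<kappa>)"
        using t1 t2 Bp by (intro mult_left_mono) auto
      finally have "local_mass v (c + z) (2 * r) \<le> B * p\<^sup>2 * (t * 2 powr \<kappa>)" .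
      moreover have "local_mass v c (2 * r) \<le> B * p\<^sup>2 * t"
      proof -
        have "B * p\<^sup>2 * 1 \<le> B * p\<^sup>2 * t" using t1 Bp by (intro mult_left_mono)
        then show ?thesis using mass[of c] unfolding p_def by simp
      qed
      ultimately have "local_mass v (c + z) (2 * r) + local_mass v c (2 * r) \<le> B * p\<^sup>2 * (t * (1 + 2 powr \<kappa>))"
        by (simp add: algebra_simps)
      then show ?thesis by (intro add_left_mono mult_left_mono) auto
    qed
    also have "\<dots> = 2 * e z + T * jump_weight \<kappa> R z"
      unfolding T_def jump_weight_def t_def by (simp add: algebra_simps)
    finally have hz: "h z \<le> 2 * e z + T * jump_weight \<kappa> R z" .
    have "0 \<le> h z" unfolding h_def by (simp add: integral_nonneg_AE)
    then have "near_weight z * h z \<le> h z"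
      using near_weight_range[of z] by (simp add: mult_left_le_one_le)
    then show ?thesis using hz by linarith
  qed
  have "(\<integral>z. near_weight z * h z \<partial>\<nu>) \<le> (\<integral>z. 2 * e z + T * jump_weight \<kappa> R z \<partial>\<nu>)"
    by (rule integral_mono[OF int_h _ h_le]) (use e_int integrable_jump_weight[OF R(1)] in simp)
  also have "\<dots> = 2 * (\<integral>z. e z \<partial>\<nu>) + T * (\<integral>z. jump_weight \<kappa> R z \<partial>\<nu>)"
    using e_int integrable_jump_weight[OF R(1)] by simp
  also have "\<dots> \<le> 2 * (2 * B * p\<^sup>2 * (J * R powr (- 2 * s))) + T * (J * R powr (- 2 * s))"
    using e_le by (intro add_mono mult_left_mono jump_weight_scaling R T0) auto
  also have "\<dots> = (6 + 2 * 2 powr \<kappa>) * J * (R powr (- 2 * s) * B * p\<^sup>2)"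
    unfolding T_def by (simp add: algebra_simps)
  finally have "(1 + N) * (\<integral>z. near_weight z * h z \<partial>\<nu>) \<le> (1 + N) * ((6 + 2 * 2 powr \<kappa>) * J * (R powr (- 2 * s) * B * p\<^sup>2))"
    using N by (intro mult_left_mono) auto
  with main show ?thesis unfolding gain_def N_def[symmetric] p_def by (simp add: mult.assoc)
qed

end

section \<open>The Liouville theorem for harmonic functions\<close>

text \<open>A nonempty open set is not negligible, so a closed condition that holds almost everywhere on an
  open set holds everywhere on it.\<close>
lemma AE_closed_imp_subset:
  fixes U S :: "'a::euclidean_space set"
  assumes "open U" "closed S" and ae: "AE x in lborel. x \<in> U \<longrightarrow> x \<in> S"
  shows "U \<subseteq> S"
proof (rule ccontr)
  assume "\<not> U \<subseteq> S"
  then have "U - S \<noteq> {}" "open (U - S)" using assms by auto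
  then have "\<not> negligible (U - S)" using open_not_negligible by blast
  moreover have "negligible (U - S)"
  proof -
    have [measurable]: "U - S \<in> sets borel" using \<open>open (U - S)\<close> by auto
    have "emeasure lborel (U - S) = 0"
      using ae by (subst AE_iff_measurable[symmetric, where P = "\<lambda>x. \<not> (x \<in> U - S)"]) auto
    then show ?thesis by (simp add: negligible_iff_emeasure0)
  qed
  ultimately show False by simp
qed

definition mixed_diff :: "('a::real_vector \<Rightarrow> real) \<Rightarrow> 'a \<Rightarrow> 'a \<Rightarrow> 'a \<Rightarrow> real" where
  "mixed_diff v a b x = v (x + a + b) - v (x + a) - v (x + b) + v x"

context levy_scaling begin

lemma harmonic_foldr_average:
  assumes "harmonic v" "\<And>g. g \<in> set gs \<Longrightarrow> unit_multiplier g"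
  shows "harmonic (foldr (average_diff \<nu>) gs v)"
  using assms by (induction gs) (auto intro: harmonic_average_diff)

text \<open>Each step halves the radius but keeps the growth weight at the scale \<open>R\<close>; hence the initial
  radius \<open>2 ^ length gs * r\<close>.\<close>
lemma local_mass_foldr_average:
  assumes v: "harmonic v" and gs: "\<And>g. g \<in> set gs \<Longrightarrow> unit_multiplier g" and R: "1 \<le> R" "R \<le> r"
    and mass: "\<And>c. local_mass v c (2 ^ length gs * r) \<le> B * ((R + norm c) powr \<kappa>)\<^sup>2"
  shows "local_mass (foldr (average_diff \<nu>) gs v) c r
    \<le> ((gain * R powr (- 2 * s)) ^ length gs * B) * ((R + norm c) powr \<kappa>)\<^sup>2"
  using gs R(2) mass
proof (induction gs arbitrary: r c)
  case Nil
  then show ?case by simp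
next
  case (Cons g gs)
  have "local_mass (foldr (average_diff \<nu>) gs v) c (2 * r)
      \<le> ((gain * R powr (- 2 * s)) ^ length gs * B) * ((R + norm c) powr \<kappa>)\<^sup>2" for c
    by (rule Cons.IH) (use Cons.prems R(1) in \<open>auto simp: mult.assoc mult.left_commute[of 2]\<close>)
  then have "local_mass (average_diff \<nu> g (foldr (average_diff \<nu>) gs v)) c r
      \<le> (gain * R powr (- 2 * s) * ((gain * R powr (- 2 * s)) ^ length gs * B)) * ((R + norm c) powr \<kappa>)\<^sup>2"
    by (intro local_mass_average_diff harmonic_foldr_average v R(1)) (use Cons.prems in auto)
  then show ?case by (simp add: mult.assoc)
qed

lemma local_mass_growth:
  fixes c :: 'a
  assumes v: "tame \<kappa> v" and B: "0 \<le> B" "\<And>x. \<bar>v x\<bar> \<le> B * (1 + norm x) powr \<kappa>"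
    and R: "1 \<le> R" and T: "0 \<le> T"
  shows "local_mass v c (T * R)
    \<le> ((B * (1 + T) powr \<kappa>)\<^sup>2 * ((T * R) ^ DIM('a) * measure lborel (ball (0::'a) 1))) * ((R + norm c) powr \<kappa>)\<^sup>2"
proof -
  define p where "p = (R + norm c) powr \<kappa>"
  have pw: "(v x)\<^sup>2 \<le> (B * (1 + T) powr \<kappa> * p)\<^sup>2" if "x \<in> ball c (T * R)" for x
  proof -
    have "norm x \<le> norm c + T * R"
      using that norm_triangle_sub[of x c] by (simp add: dist_norm norm_minus_commute)
    moreover have "0 \<le> T * norm c" using T by simp
    ultimately have le: "1 + norm x \<le> (1 + T) * (R + norm c)" using R by (simp add: algebra_simps)
    have "(1 + norm x) powr \<kappa> \<le> ((1 + T) * (R + norm c)) powr \<kappa>"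
      using le kappa_nonneg by (intro powr_mono2) auto
    then have "(1 + norm x) powr \<kappa> \<le> (1 + T) powr \<kappa> * p" unfolding p_def by (simp only: powr_mult)
    then have "B * (1 + norm x) powr \<kappa> \<le> B * ((1 + T) powr \<kappa> * p)" using B(1) by (intro mult_left_mono)
    then have "\<bar>v x\<bar> \<le> B * (1 + T) powr \<kappa> * p" using B(2)[of x] by (simp add: mult.assoc)
    then show ?thesis using power_mono[of "\<bar>v x\<bar>" _ 2] by simp
  qed
  have "local_mass v c (T * R) \<le> (\<integral>x. indicator (ball c (T * R)) x * (B * (1 + T) powr \<kappa> * p)\<^sup>2 \<partial>lborel)"
    unfolding local_mass_def
    by (rule integral_mono; (intro integrable_indicator_ball continuous_intros tame_cont[OF v])?)
      (use pw in \<open>auto simp: indicator_def\<close>)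
  also have "\<dots> = measure lborel (ball c (T * R)) * (B * (1 + T) powr \<kappa> * p)\<^sup>2"
    by simp
  also have "measure lborel (ball c (T * R)) = (T * R) ^ DIM('a) * measure lborel (ball (0::'a) 1)"
    using content_ball_conv_unit_ball[of "T * R" c] T R by simp
  finally show ?thesis unfolding p_def by (simp add: power_mult_distrib algebra_simps)
qed

text \<open>The mass in the ball of radius \<open>R\<close> is at most a constant times \<open>R powr a\<close>, where \<open>a\<close> collects the
  dimension, twice the growth exponent, and \<open>- 2 * s\<close> per iteration. When \<open>a < 0\<close>, letting \<open>R\<close>
  tend to infinity gives zero.\<close>
lemma foldr_average_eq_0:
  assumes v: "harmonic v" and gs: "\<And>g. g \<in> set gs \<Longrightarrow> unit_multiplier g"
    and long: "DIM('a) + 2 * \<kappa> < 2 * s * length gs"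
  shows "foldr (average_diff \<nu>) gs v = (\<lambda>x. 0)"
proof -
  define k where "k = length gs"
  define w where "w = foldr (average_diff \<nu>) gs v"
  have vt: "tame \<kappa> v" using v by (simp add: harmonic_def)
  have wt: "tame \<kappa> w" using harmonic_foldr_average[OF v gs] by (simp add: harmonic_def w_def)
  have wc: "continuous_on UNIV w" using tame_cont[OF wt] .
  obtain B where B: "B \<ge> 0" "\<And>x. \<bar>v x\<bar> \<le> B * (1 + norm x) powr \<kappa>"
    using tame_growth[OF vt] by blast
  define A where "A = (gain ^ k * ((B * (1 + 2 ^ k) powr \<kappa>)\<^sup>2 * ((2 ^ k) ^ DIM('a) * measure lborel (ball (0::'a) 1))))"
  define a where "a = real DIM('a) + 2 * \<kappa> - 2 * s * k"
  have a: "a < 0" using long unfolding a_def k_def by simp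
  have bound: "local_mass w 0 R \<le> A * R powr a" if R: "1 \<le> R" for R
  proof -
    have R0: "0 < R" using R by simp
    have "local_mass w 0 R \<le> ((gain * R powr (- 2 * s)) ^ k *
      ((B * (1 + 2 ^ k) powr \<kappa>)\<^sup>2 * ((2 ^ k * R) ^ DIM('a) * measure lborel (ball (0::'a) 1)))) * ((R + norm (0::'a)) powr \<kappa>)\<^sup>2"
      unfolding w_def k_def
      by (rule local_mass_foldr_average[OF v gs R order_refl]) (auto intro: local_mass_growth vt B R)
    also have "\<dots> = A * (((R powr (- 2 * s)) ^ k * R ^ DIM('a)) * (R powr \<kappa>)\<^sup>2)"
      unfolding A_def by (simp add: power_mult_distrib mult_ac)
    also have "((R powr (- 2 * s)) ^ k * R ^ DIM('a)) * (R powr \<kappa>)\<^sup>2 = R powr a"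
      using R0 unfolding a_def
      by (simp add: powr_powr powr_realpow[symmetric] powr_add[symmetric] algebra_simps)
    finally show ?thesis .
  qed
  have zero: "local_mass w 0 \<rho> \<le> 0" for \<rho>
  proof (rule tendsto_lowerbound)
    have "((\<lambda>R. R powr a) \<longlongrightarrow> 0) at_top"
      using tendsto_neg_powr[OF a filterlim_ident] .
    then show "((\<lambda>R. A * R powr a) \<longlongrightarrow> 0) at_top" using tendsto_mult_right_zero by blast
    show "\<forall>\<^sub>F R in at_top. local_mass w 0 \<rho> \<le> A * R powr a"
      using eventually_ge_at_top[of "max 1 \<rho>"]
    proof eventually_elim
      case (elim R)
      have "local_mass w 0 \<rho> \<le> local_mass w 0 R"
        unfolding local_mass_def
        by (rule integral_mono; (intro integrable_indicator_ball continuous_intros wc)?)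
          (use elim in \<open>auto simp: indicator_def\<close>)
      then show ?case using bound[of R] elim by simp
    qed
  qed auto
  have "w x = 0" for x
  proof -
    define \<rho> where "\<rho> = norm x + 1"
    have int: "integrable lborel (\<lambda>x. indicator (ball 0 \<rho>) x * (w x)\<^sup>2)"
      by (intro integrable_indicator_ball continuous_intros wc)
    have "local_mass w 0 \<rho> = 0"
      using zero[of \<rho>] by (intro antisym) (auto simp: local_mass_def integral_nonneg_AE)
    then have "AE x in lborel. indicator (ball 0 \<rho>) x * (w x)\<^sup>2 = 0"
      unfolding local_mass_def by (subst (asm) integral_nonneg_eq_0_iff_AE[OF int]) auto
    then have "AE x in lborel. x \<in> ball 0 \<rho> \<longrightarrow> x \<in> {x. w x = 0}"
      by eventually_elim (auto simp: indicator_def)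
    moreover have "closed {x. w x = 0}"
      using continuous_closed_vimage[of "{0}" w] wc by (simp add: vimage_def continuous_on_eq_continuous_at)
    ultimately have "ball 0 \<rho> \<subseteq> {x. w x = 0}" by (intro AE_closed_imp_subset) auto
    moreover have "x \<in> ball 0 \<rho>" by (simp add: \<rho>_def)
    ultimately show ?thesis by blast
  qed
  then show ?thesis unfolding w_def by blast
qed

text \<open>The exceptional set of jumps depends on \<open>x\<close>. Restricting to a countable dense set of points and then
  using continuity makes it uniform, so that almost all small jumps are periods; the periods form a
  closed subgroup.\<close>
lemma constant_if_periodic_AE:
  assumes D: "continuous_on UNIV D"
    and per: "\<And>x. AE z in \<nu>. norm z \<le> 1 \<longrightarrow> D (x + z) = (D x :: real)"
  shows "D x = D 0"
proof -
  define P where "P = {z. \<forall>x. D (x + z) = D x}"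
  have cl: "closed {z. D (f z) = D (h z)}" if "continuous_on UNIV f" "continuous_on UNIV h" for f h :: "'a \<Rightarrow> 'a"
    by (intro closed_Collect_eq continuous_on_compose2[OF D] that) auto
  obtain X :: "'a set" where X: "countable X" "\<And>U. open U \<Longrightarrow> U \<noteq> {} \<Longrightarrow> \<exists>x\<in>X. x \<in> U"
    using countable_dense_setE by blast
  have "AE z in \<nu>. \<forall>x\<in>X. norm z \<le> 1 \<longrightarrow> D (x + z) = D x"
    using X(1) per by (subst AE_ball_countable) auto
  then have "AE z in \<nu>. norm z \<le> 1 \<longrightarrow> z \<in> P"
  proof eventually_elim
    case (elim z)
    have "D (x + z) = D x" if "norm z \<le> 1" for x
    proof (rule ccontr)
      assume "D (x + z) \<noteq> D x"
      moreover have "open (- {x. D (x + z) = D x})"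
        by (intro open_Compl cl continuous_intros)
      moreover have "x \<in> - {x. D (x + z) = D x}" using \<open>D (x + z) \<noteq> D x\<close> by simp
      ultimately have "\<exists>y\<in>X. y \<in> - {x. D (x + z) = D x}" using X(2) by (metis empty_iff)
      then obtain y where "y \<in> X" "D (y + z) \<noteq> D y" by auto
      then show False using elim that by blast
    qed
    then show ?case by (simp add: P_def)
  qed
  moreover have "closed P"
  proof -
    have "P = (\<Inter>x. {z. D (x + z) = D x})" by (auto simp: P_def)
    moreover have "closed {z. D (x + z) = D x}" for x by (intro cl continuous_intros)
    ultimately show ?thesis by auto
  qed
  moreover have "x + y \<in> P" if "x \<in> P" "y \<in> P" for x y
    using that by (simp add: P_def add.assoc[symmetric])
  moreover have "- x \<in> P" if "x \<in> P" for x
  proof -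
    have "D (y - x + x) = D (y - x)" for y using that unfolding P_def by blast
    then show ?thesis by (simp add: P_def)
  qed
  moreover have "0 \<in> P" by (simp add: P_def)
  ultimately have "P = UNIV" using spanning[of P] by blast
  then have "x \<in> P" by simp
  then have "D (0 + x) = D 0" unfolding P_def by blast
  then show ?thesis by simp
qed

lemma mixed_diff_average:
  assumes v: "tame \<kappa> v" and g: "unit_multiplier g"
  shows "integrable \<nu> (\<lambda>z. near_weight z * (g z * (mixed_diff v a b (x + z) - mixed_diff v a b x)))"
    and "mixed_diff (average_diff \<nu> g v) a b x
      = (\<integral>z. near_weight z * (g z * (mixed_diff v a b (x + z) - mixed_diff v a b x)) \<partial>\<nu>)"
proof -
  note i = average_diff_integrable[OF v g]
  define F where "F z = near_weight z * (g z * (v (x + a + b + z) - v (x + a + b))) - near_weight z * (g z * (v (x + a + z) - v (x + a)))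
     - near_weight z * (g z * (v (x + b + z) - v (x + b))) + near_weight z * (g z * (v (x + z) - v x))" for z
  have F: "F z = near_weight z * (g z * (mixed_diff v a b (x + z) - mixed_diff v a b x))" for z
  proof -
    have "x + z + a = x + a + z" "x + z + b = x + b + z" "x + a + z + b = x + a + b + z"
      by (simp_all add: algebra_simps)
    then show ?thesis unfolding F_def mixed_diff_def by (simp add: algebra_simps)
  qed
  have "integrable \<nu> (\<lambda>z. F z)" unfolding F_def using i by simp
  then show "integrable \<nu> (\<lambda>z. near_weight z * (g z * (mixed_diff v a b (x + z) - mixed_diff v a b x)))"
    by (simp only: F)
  have "mixed_diff (average_diff \<nu> g v) a b x = (\<integral>z. F z \<partial>\<nu>)"
    unfolding mixed_diff_def average_diff_def F_def using i by simp
  then show "mixed_diff (average_diff \<nu> g v) a b x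
      = (\<integral>z. near_weight z * (g z * (mixed_diff v a b (x + z) - mixed_diff v a b x)) \<partial>\<nu>)"
    by (simp only: F)
qed

text \<open>Let \<open>h z\<close> be the increment by the jump \<open>z\<close> of a mixed second difference of \<open>v\<close>. The hypothesis with the
  density \<open>g = h / (1 + \<bar>h\<bar>)\<close> makes the integral of the nonnegative function \<open>g * h\<close> vanish, so \<open>h\<close>
  vanishes almost everywhere and the mixed difference does not depend on \<open>x\<close>. It is
  then additive in each step, whence it grows quadratically when both steps are multiplied by
  \<open>n\<close>, unless it is zero; growth with exponent \<open>\<kappa> < 2\<close> excludes the former.\<close>
lemma affine_if_averages_affine:
  assumes v: "tame \<kappa> v"
    and aff: "\<And>g a b x. unit_multiplier g \<Longrightarrow> mixed_diff (average_diff \<nu> g v) a b x = 0"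
  shows "mixed_diff v a b x = 0"
proof -
  have vc: "continuous_on UNIV v" using tame_cont[OF v] .
  have Dc: "continuous_on UNIV (mixed_diff v a b)" for a b
    unfolding mixed_diff_def[abs_def]
    by (intro continuous_intros continuous_on_compose2[OF vc]) auto
  have "AE z in \<nu>. norm z \<le> 1 \<longrightarrow> mixed_diff v a b (x + z) = mixed_diff v a b x" for a b x
  proof -
    define h where "h z = mixed_diff v a b (x + z) - mixed_diff v a b x" for z
    define g where "g z = h z / (1 + \<bar>h z\<bar>)" for z
    have hc: "continuous_on UNIV h" unfolding h_def by (intro continuous_intros continuous_on_compose2[OF Dc]) auto
    have [measurable]: "h \<in> borel_measurable borel" by (intro borel_measurable_continuous_onI hc)
    have g: "unit_multiplier g"
      unfolding unit_multiplier_def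
    proof
      show "g \<in> borel_measurable borel" unfolding g_def by measurable
      show "\<forall>z. \<bar>g z\<bar> \<le> 1" unfolding g_def by (auto simp: field_simps abs_if)
    qed
    have gh: "0 \<le> g z * h z" "g z * h z = 0 \<longleftrightarrow> h z = 0" for z
      unfolding g_def by (auto simp: zero_le_mult_iff zero_le_divide_iff)
    have "(\<integral>z. near_weight z * (g z * h z) \<partial>\<nu>) = 0"
      using mixed_diff_average(2)[OF v g, of a b x] aff[OF g, of a b x] by (simp add: h_def)
    moreover have "integrable \<nu> (\<lambda>z. near_weight z * (g z * h z))"
      using mixed_diff_average(1)[OF v g, of a b x] by (simp add: h_def)
    moreover have "AE z in \<nu>. 0 \<le> near_weight z * (g z * h z)"
      by (intro AE_I2 mult_nonneg_nonneg[OF near_weight_range(1)] gh(1))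
    ultimately have "AE z in \<nu>. near_weight z * (g z * h z) = 0"
      by (simp only: integral_nonneg_eq_0_iff_AE)
    then show ?thesis
    proof eventually_elim
      case (elim z)
      show ?case
      proof (cases "z = 0")
        case False
        then show ?thesis using elim gh(2)[of z] by (auto simp: near_weight_def h_def)
      qed simp
    qed
  qed
  then have const: "mixed_diff v a b x = mixed_diff v a b 0" for a b x
    by (rule constant_if_periodic_AE[OF Dc])
  have add1: "mixed_diff v (a + a') b 0 = mixed_diff v a b 0 + mixed_diff v a' b 0" for a a' b
  proof -
    have "mixed_diff v (a + a') b 0 = mixed_diff v a b (0 + a') + mixed_diff v a' b 0"
      by (simp add: mixed_diff_def algebra_simps)
    then show ?thesis using const[of a b "0 + a'"] by simp
  qed
  have sym: "mixed_diff v a b 0 = mixed_diff v b a 0" for a b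
    by (simp add: mixed_diff_def algebra_simps)
  \<comment> \<open>A biadditive function is homogeneous over the natural numbers in each step, which replaces bilinearity.\<close>
  have scale1: "mixed_diff v (real n *\<^sub>R a) b 0 = real n * mixed_diff v a b 0" for n a b
  proof (induction n)
    case 0
    show ?case by (simp add: mixed_diff_def)
  next
    case (Suc n)
    have "real (Suc n) *\<^sub>R a = real n *\<^sub>R a + a" by (simp add: algebra_simps)
    then show ?case using Suc add1[of "real n *\<^sub>R a" a b] by (simp add: algebra_simps)
  qed
  have scale2: "mixed_diff v (real n *\<^sub>R a) (real n *\<^sub>R b) 0 = (real n)\<^sup>2 * mixed_diff v a b 0" for n
    unfolding power2_eq_square
    by (simp only: scale1[of n a "real n *\<^sub>R b"] sym[of a "real n *\<^sub>R b"] scale1[of n b a] sym[of b a] mult.assoc)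
  obtain B where B: "B \<ge> 0" "\<And>x. \<bar>v x\<bar> \<le> B * (1 + norm x) powr \<kappa>"
    using tame_growth[OF v] by blast
  define C where "C = 4 * (B * (1 + norm a + norm b) powr \<kappa>)"
  have bound: "\<bar>mixed_diff v a b 0\<bar> \<le> C * real n powr (\<kappa> - 2)" if n: "1 \<le> n" for n :: nat
  proof -
    let ?n = "real n"
    have each: "\<bar>v y\<bar> \<le> B * ((1 + norm a + norm b) powr \<kappa> * ?n powr \<kappa>)" if "norm y \<le> ?n * norm a + ?n * norm b" for y
    proof -
      have "1 + norm y \<le> (1 + norm a + norm b) * ?n" using that n by (simp add: algebra_simps)
      then have "(1 + norm y) powr \<kappa> \<le> ((1 + norm a + norm b) * ?n) powr \<kappa>"
        using kappa_nonneg by (intro powr_mono2) auto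
      then have "(1 + norm y) powr \<kappa> \<le> (1 + norm a + norm b) powr \<kappa> * ?n powr \<kappa>" by (simp only: powr_mult)
      then have "B * (1 + norm y) powr \<kappa> \<le> B * ((1 + norm a + norm b) powr \<kappa> * ?n powr \<kappa>)"
        using B(1) by (intro mult_left_mono)
      then show ?thesis using B(2)[of y] by linarith
    qed
    have "\<bar>mixed_diff v (?n *\<^sub>R a) (?n *\<^sub>R b) 0\<bar> \<le> C * ?n powr \<kappa>"
    proof -
      have "norm (?n *\<^sub>R a + ?n *\<^sub>R b) \<le> ?n * norm a + ?n * norm b"
        using norm_triangle_ineq[of "?n *\<^sub>R a" "?n *\<^sub>R b"] by simp
      then show ?thesis
        using each[of "?n *\<^sub>R a + ?n *\<^sub>R b"] each[of "?n *\<^sub>R a"] each[of "?n *\<^sub>R b"] each[of 0]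
        unfolding mixed_diff_def C_def by simp
    qed
    then have "?n\<^sup>2 * \<bar>mixed_diff v a b 0\<bar> \<le> C * ?n powr \<kappa>" unfolding scale2 by (simp add: abs_mult)
    then have "\<bar>mixed_diff v a b 0\<bar> \<le> C * ?n powr \<kappa> / ?n\<^sup>2"
      using n by (simp add: pos_le_divide_eq mult.commute)
    also have "\<dots> = C * ?n powr (\<kappa> - 2)"
      using n by (simp add: powr_diff powr_numeral)
    finally show ?thesis .
  qed
  have "\<bar>mixed_diff v a b 0\<bar> \<le> 0"
  proof (rule tendsto_lowerbound)
    have "(\<lambda>n. real n powr (\<kappa> - 2)) \<longlonglongrightarrow> 0"
      using kappa_less_2 by (intro tendsto_neg_powr filterlim_real_sequentially) auto
    then show "(\<lambda>n. C * real n powr (\<kappa> - 2)) \<longlonglongrightarrow> 0" using tendsto_mult_right_zero by blast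
    show "\<forall>\<^sub>F n in sequentially. \<bar>mixed_diff v a b 0\<bar> \<le> C * real n powr (\<kappa> - 2)"
      using eventually_ge_at_top[of 1] by eventually_elim (rule bound)
  qed auto
  then show ?thesis using const[of a b x] by simp
qed

text \<open>The Liouville theorem: a harmonic function is affine. Induction on the length of the
  averaging sequences: long ones give zero, and affinity passes from sequences of length \<open>j + 1\<close> to those
  of length \<open>j\<close>, finally to the empty one.\<close>
theorem harmonic_mixed_diff_eq_0:
  assumes v: "harmonic v"
  shows "mixed_diff v a b x = 0"
proof -
  \<comment> \<open>Number of iterations at which the gain exceeds volume and growth.\<close>
  obtain k :: nat where "(DIM('a) + 2 * \<kappa>) / (2 * s) < k" using reals_Archimedean2 by blast
  then have k: "DIM('a) + 2 * \<kappa> < 2 * s * k" using s_pos by (simp add: field_simps)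
  have "\<forall>a b x. mixed_diff v a b x = 0"
    if "\<And>gs a b x. length gs = j \<Longrightarrow> (\<And>g. g \<in> set gs \<Longrightarrow> unit_multiplier g) \<Longrightarrow>
        mixed_diff (foldr (average_diff \<nu>) gs v) a b x = 0" for j
    using that
  proof (induction j)
    case 0
    then show ?case using "0"[of "[]"] by simp
  next
    case (Suc j)
    show ?case
    proof (rule Suc.IH)
      fix gs :: "('a \<Rightarrow> real) list" and a b x assume gs: "length gs = j" "\<And>g. g \<in> set gs \<Longrightarrow> unit_multiplier g"
      have "tame \<kappa> (foldr (average_diff \<nu>) gs v)"
        using harmonic_foldr_average[OF v gs(2)] by (simp add: harmonic_def)
      then show "mixed_diff (foldr (average_diff \<nu>) gs v) a b x = 0"
      proof (rule affine_if_averages_affine)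
        fix g :: "'a \<Rightarrow> real" and a b x assume "unit_multiplier g"
        then show "mixed_diff (average_diff \<nu> g (foldr (average_diff \<nu>) gs v)) a b x = 0"
          using Suc.prems[of "g # gs" a b x] gs by auto
      qed
    qed
  qed
  from this[of k] show ?thesis
    using foldr_average_eq_0[OF v] k by (simp add: mixed_diff_def)
qed

end

section \<open>A maximum principle for monotone nonlinearities\<close>

text \<open>A smooth version of \<open>norm x powr b\<close>, concave as a function of \<open>(norm x)\<^sup>2\<close>.\<close>
definition barrier :: "real \<Rightarrow> 'a::real_inner \<Rightarrow> real" where
  "barrier b x = (1 + (norm x)\<^sup>2) powr (b / 2)"

lemma powr_le_tangent:
  fixes p T q :: real
  assumes "0 < p" "0 < T" "0 \<le> q" "q \<le> 1"
  shows "p powr q \<le> T powr (q - 1) * (q * p + (1 - q) * T)"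
proof -
  have "p powr q * T powr (1 - q) \<le> q * p + (1 - q) * T"
    using assms by (intro Youngs_inequality_0) auto
  then have "T powr (q - 1) * (p powr q * T powr (1 - q)) \<le> T powr (q - 1) * (q * p + (1 - q) * T)"
    by (intro mult_left_mono) auto
  moreover have "T powr (q - 1) * (p powr q * T powr (1 - q)) = p powr q"
    using assms(2) by (simp add: mult.left_commute powr_add[symmetric])
  ultimately show ?thesis by simp
qed

text \<open>With \<open>q = b / 2\<close>, the barrier is the concave function \<open>t powr q\<close> of \<open>1 + (norm x)\<^sup>2\<close>. The two
  arguments at \<open>x + z\<close> and \<open>x - z\<close> have mean \<open>A + m\<close>, where \<open>A\<close> is the argument at \<open>x\<close> and \<open>m = (norm z)\<^sup>2\<close>. The tangent at \<open>A\<close> gives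
  a bound of order \<open>m\<close>, the tangent at \<open>A + m\<close> a bound of order \<open>m powr q\<close>. Both are
  uniform in \<open>x\<close>.\<close>
lemma second_diff_barrier_le:
  fixes x z :: "'a::real_inner"
  assumes b: "0 < b" "b < 2"
  shows "second_diff (barrier b) x z \<le> 2 * jump_weight b 1 z"
proof -
  define q where "q = b / 2"
  define A where "A = 1 + (norm x)\<^sup>2"
  define m where "m = (norm z)\<^sup>2"
  have q: "0 < q" "q < 1" using b by (auto simp: q_def)
  have A: "1 \<le> A" by (simp add: A_def)
  have m: "0 \<le> m" by (simp add: m_def)
  define p1 where "p1 = 1 + (norm (x + z))\<^sup>2"
  define p2 where "p2 = 1 + (norm (x - z))\<^sup>2"
  have p: "0 < p1" "0 < p2" unfolding p1_def p2_def by (simp_all add: add_pos_nonneg)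
  have sum: "p1 + p2 = 2 * (A + m)"
    unfolding p1_def p2_def A_def m_def by (simp add: power2_norm_eq_inner inner_simps inner_commute)
  have tangent: "p1 powr q + p2 powr q \<le> T powr (q - 1) * (2 * q * (A + m) + 2 * (1 - q) * T)" if "0 < T" for T
  proof -
    have "p1 powr q + p2 powr q \<le> T powr (q - 1) * (q * p1 + (1 - q) * T) + T powr (q - 1) * (q * p2 + (1 - q) * T)"
      using q p that by (intro add_mono powr_le_tangent) auto
    also have "\<dots> = T powr (q - 1) * (q * (p1 + p2) + 2 * (1 - q) * T)" by (simp add: algebra_simps)
    finally show ?thesis unfolding sum by (simp only: mult.assoc mult.left_commute[of q 2])
  qed
  have sd: "second_diff (barrier b) x z = p1 powr q + p2 powr q - 2 * A powr q"
    by (simp add: second_diff_def barrier_def p1_def p2_def A_def q_def)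
  have powr1: "T powr (q - 1) * T = T powr q" if "0 < T" for T :: real
    using that by (simp add: powr_diff)
  show ?thesis
  proof (cases "norm z \<le> 1")
    case True
    have "p1 powr q + p2 powr q \<le> A powr (q - 1) * (2 * q * (A + m) + 2 * (1 - q) * A)"
      using tangent[of A] A by simp
    also have "\<dots> = 2 * (A powr (q - 1) * A) + 2 * q * m * A powr (q - 1)" by (simp add: algebra_simps)
    also have "\<dots> = 2 * A powr q + 2 * q * m * A powr (q - 1)" using powr1[of A] A by simp
    also have "2 * q * m * A powr (q - 1) \<le> 2 * 1 * m * 1"
    proof (intro mult_mono)
      have "A powr (q - 1) \<le> A powr 0" using A q by (intro powr_mono) auto
      then show "A powr (q - 1) \<le> 1" using A by simp
    qed (use q m in auto)
    finally have "second_diff (barrier b) x z \<le> 2 * (m * 1)" unfolding sd by simp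
    also have "\<dots> \<le> 2 * (m * (1 + norm z) powr b)"
      using b m by (intro mult_left_mono) (auto simp: ge_one_powr_ge_zero)
    also have "\<dots> = 2 * jump_weight b 1 z"
      using True by (simp add: jump_weight_def m_def min_absorb2 power_le_one)
    finally show ?thesis .
  next
    case False
    then have m1: "1 \<le> m" by (simp add: m_def one_le_power)
    have "p1 powr q + p2 powr q \<le> (A + m) powr (q - 1) * (2 * q * (A + m) + 2 * (1 - q) * (A + m))"
      using tangent[of "A + m"] A m by simp
    also have "\<dots> = 2 * (A * (A + m) powr (q - 1)) + 2 * (m * (A + m) powr (q - 1))" by (simp add: algebra_simps)
    also have "\<dots> \<le> 2 * (A * A powr (q - 1)) + 2 * (m * m powr (q - 1))"
      using A m1 q by (intro add_mono mult_left_mono powr_mono2') auto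
    also have "\<dots> = 2 * A powr q + 2 * m powr q" using powr1[of A] powr1[of m] A m1 by (simp add: mult.commute)
    finally have "second_diff (barrier b) x z \<le> 2 * m powr q" unfolding sd by simp
    also have "m powr q = norm z powr b"
    proof -
      have "norm z powr (2 * q) = m powr q"
        unfolding m_def using False by (simp add: powr_powr[symmetric] powr_numeral)
      then show ?thesis by (simp add: q_def)
    qed
    also have "norm z powr b \<le> (1 + norm z) powr b" using b by (intro powr_mono2) auto
    also have "\<dots> = jump_weight b 1 z" using False by (simp add: jump_weight_def min_absorb1 one_le_power)
    finally show ?thesis by simp
  qed
qed

lemma barrier_continuous: "continuous_on UNIV (barrier b)"
  unfolding barrier_def[abs_def]
  by (intro continuous_intros) (auto simp: add_pos_nonneg less_imp_neq[THEN not_sym])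

lemma attains_max_minus_barrier:
  fixes u :: "'a::euclidean_space \<Rightarrow> real"
  assumes cont: "continuous_on UNIV u" and B: "\<And>x. \<bar>u x\<bar> \<le> B * (1 + norm x) powr \<kappa>"
    and k: "0 \<le> \<kappa>" "\<kappa> < b" and e: "0 < \<epsilon>"
  obtains x0 where "\<And>x. u x - \<epsilon> * barrier b x \<le> u x0 - \<epsilon> * barrier b x0"
proof -
  define w where "w x = u x - \<epsilon> * barrier b x" for x
  have wc: "continuous_on UNIV w" unfolding w_def by (intro continuous_intros cont barrier_continuous)
  have B0: "0 \<le> B" using B[of 0] by auto
  have "((\<lambda>t. t powr (\<kappa> - b)) \<longlongrightarrow> 0) at_top" using k by (intro tendsto_neg_powr filterlim_ident) auto
  then have "((\<lambda>t. B * 2 powr \<kappa> * t powr (\<kappa> - b)) \<longlongrightarrow> 0) at_top" using tendsto_mult_right_zero by blast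
  then have e1: "\<forall>\<^sub>F t in at_top. B * 2 powr \<kappa> * t powr (\<kappa> - b) < \<epsilon> / 2" by (rule order_tendstoD(2)) (use e in simp)
  have "((\<lambda>t. t powr (- b)) \<longlongrightarrow> 0) at_top" using k by (intro tendsto_neg_powr filterlim_ident) auto
  then have "((\<lambda>t. \<bar>w 0\<bar> * t powr (- b)) \<longlongrightarrow> 0) at_top" using tendsto_mult_right_zero by blast
  then have e2: "\<forall>\<^sub>F t in at_top. \<bar>w 0\<bar> * t powr (- b) < \<epsilon> / 2" by (rule order_tendstoD(2)) (use e in simp)
  have "\<forall>\<^sub>F t in at_top. B * 2 powr \<kappa> * t powr (\<kappa> - b) < \<epsilon> / 2 \<and> \<bar>w 0\<bar> * t powr (- b) < \<epsilon> / 2 \<and> 1 \<le> t"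
    using e1 e2 eventually_ge_at_top[of 1] by eventually_elim auto
  then obtain \<rho> where \<rho>: "\<And>t. \<rho> \<le> t \<Longrightarrow> B * 2 powr \<kappa> * t powr (\<kappa> - b) < \<epsilon> / 2 \<and> \<bar>w 0\<bar> * t powr (- b) < \<epsilon> / 2 \<and> 1 \<le> t"
    unfolding eventually_at_top_linorder by blast
  have far: "w x \<le> w 0" if x: "\<rho> \<le> norm x" for x
  proof -
    define t where "t = norm x"
    have t: "B * 2 powr \<kappa> * t powr (\<kappa> - b) < \<epsilon> / 2" "\<bar>w 0\<bar> * t powr (- b) < \<epsilon> / 2" "1 \<le> t"
      using \<rho>[OF x] by (auto simp: t_def)
    have tb: "0 < t powr b" using t(3) by simp
    have "(1 + t) powr \<kappa> \<le> (2 * t) powr \<kappa>" using t(3) k by (intro powr_mono2) auto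
    then have "(1 + t) powr \<kappa> \<le> 2 powr \<kappa> * t powr \<kappa>" by (simp only: powr_mult)
    then have "B * (1 + t) powr \<kappa> \<le> B * (2 powr \<kappa> * t powr \<kappa>)" using B0 by (intro mult_left_mono)
    then have "u x \<le> B * (2 powr \<kappa> * t powr \<kappa>)" using B[of x] unfolding t_def by linarith
    also have "\<dots> = (B * 2 powr \<kappa> * t powr (\<kappa> - b)) * t powr b" using t(3) by (simp add: powr_diff)
    also have "\<dots> \<le> \<epsilon> / 2 * t powr b" using t(1) tb by (intro mult_right_mono) auto
    finally have u: "u x \<le> \<epsilon> / 2 * t powr b" .
    have "\<bar>w 0\<bar> = (\<bar>w 0\<bar> * t powr (- b)) * t powr b"
      unfolding mult.assoc powr_add[symmetric] using t(3) by simp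
    also have "\<dots> \<le> \<epsilon> / 2 * t powr b" using t(2) tb by (intro mult_right_mono) auto
    finally have w0: "\<bar>w 0\<bar> \<le> \<epsilon> / 2 * t powr b" .
    have "t powr b = (t\<^sup>2) powr (b / 2)" 
    proof -
      have "t\<^sup>2 = t powr 2" using t(3) by simp
      then show ?thesis by (simp only: powr_powr) simp
    qed
    also have "\<dots> \<le> barrier b x" unfolding barrier_def t_def using k by (intro powr_mono2) auto
    finally have "\<epsilon> * t powr b \<le> \<epsilon> * barrier b x" using e by (intro mult_left_mono) auto
    then have "w x \<le> - (\<epsilon> / 2 * t powr b)" using u unfolding w_def by argo
    then show ?thesis using w0 by linarith
  qed
  obtain x0 where x0: "x0 \<in> cball 0 (max 0 \<rho>)" "\<And>y. y \<in> cball 0 (max 0 \<rho>) \<Longrightarrow> w y \<le> w x0"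
    using continuous_attains_sup[of "cball 0 (max 0 \<rho>)" w] continuous_on_subset[OF wc] by auto
  have "w x \<le> w x0" for x
  proof (cases "norm x \<le> max 0 \<rho>")
    case True
    then show ?thesis using x0(2)[of x] by simp
  next
    case False
    then have "w x \<le> w 0" using far[of x] by auto
    also have "\<dots> \<le> w x0" using x0(2)[of 0] by simp
    finally show ?thesis .
  qed
  then show ?thesis using that unfolding w_def by blast
qed

text \<open>At a maximum point \<open>x0\<close> of \<open>u - \<epsilon> * barrier b\<close> the second differences of \<open>u\<close> are at most those of the
  barrier times \<open>\<epsilon>\<close>, so \<open>f (u x0)\<close> is of order \<open>\<epsilon>\<close> from above. Since \<open>u x - \<epsilon> * barrier b x \<le> u x0\<close>, monotonicity transfers
  this to \<open>f (u x - \<epsilon> * barrier b x)\<close>; let \<open>\<epsilon>\<close> tend to zero.\<close>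
lemma nonlinearity_nonpos:
  fixes u :: "'a::euclidean_space \<Rightarrow> real"
  assumes cont: "continuous_on UNIV u" and B: "\<And>x. \<bar>u x\<bar> \<le> B * (1 + norm x) powr \<kappa>"
    and k: "0 \<le> \<kappa>" "\<kappa> < b" "b < 2"
    and intb: "integrable \<nu> (jump_weight b 1)"
    and intu: "\<And>x. integrable \<nu> (second_diff u x)"
    and f: "continuous_on UNIV f" "mono f"
    and sol: "\<And>x. levy_op \<nu> u x = f (u x)"
  shows "f (u x) \<le> 0"
proof -
  define I where "I = (\<integral>z. jump_weight b 1 z \<partial>\<nu>)"
  have le: "f (u x - \<epsilon> * barrier b x) \<le> \<epsilon> * (2 * I)" if e: "0 < \<epsilon>" for \<epsilon>
  proof -
    obtain x0 where x0: "\<And>x. u x - \<epsilon> * barrier b x \<le> u x0 - \<epsilon> * barrier b x0"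
      using attains_max_minus_barrier[OF cont B k(1,2) e] by blast
    have "second_diff u x0 z \<le> \<epsilon> * (2 * jump_weight b 1 z)" for z
    proof -
      have "second_diff u x0 z \<le> \<epsilon> * second_diff (barrier b) x0 z"
        using x0[of "x0 + z"] x0[of "x0 - z"] unfolding second_diff_def by (simp add: algebra_simps)
      also have "\<dots> \<le> \<epsilon> * (2 * jump_weight b 1 z)"
        using e k by (intro mult_left_mono second_diff_barrier_le) auto
      finally show ?thesis .
    qed
    then have "levy_op \<nu> u x0 \<le> (\<integral>z. \<epsilon> * (2 * jump_weight b 1 z) \<partial>\<nu>)"
      unfolding levy_op_def using intu intb by (intro integral_mono) auto
    then have "f (u x0) \<le> \<epsilon> * (2 * I)" using sol[of x0] by (simp add: I_def)
    moreover have "f (u x - \<epsilon> * barrier b x) \<le> f (u x0)"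
    proof (rule monoD[OF f(2)])
      have "0 \<le> \<epsilon> * barrier b x0" using e by (simp add: barrier_def)
      then show "u x - \<epsilon> * barrier b x \<le> u x0" using x0[of x] by linarith
    qed
    ultimately show ?thesis by linarith
  qed
  have fc: "isCont f y" for y using f(1) by (simp add: continuous_on_eq_continuous_at)
  have "((\<lambda>\<epsilon>. f (u x - \<epsilon> * barrier b x)) \<longlongrightarrow> f (u x - 0 * barrier b x)) (at_right 0)"
    by (rule isCont_tendsto_compose[OF fc]) (intro tendsto_intros)
  moreover have "((\<lambda>\<epsilon>. \<epsilon> * (2 * I)) \<longlongrightarrow> 0 * (2 * I)) (at_right 0)"
    by (intro tendsto_intros)
  moreover have "\<forall>\<^sub>F \<epsilon> in at_right 0. f (u x - \<epsilon> * barrier b x) \<le> \<epsilon> * (2 * I)"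
    using le by (auto simp: eventually_at_right_less intro: eventually_mono[OF eventually_at_right_less])
  ultimately have "f (u x - 0 * barrier b x) \<le> 0 * (2 * I)"
    by (intro tendsto_le[of "at_right 0"]) auto
  then show ?thesis by simp
qed

section \<open>The Levy measure of a stable operator\<close>

text \<open>Near zero the integrand behaves like \<open>r powr (1 - 2 * s)\<close>, integrable as \<open>s < 1\<close>; at infinity like
  \<open>r powr (b - 1 - 2 * s)\<close>, integrable as \<open>b < 2 * s\<close>.\<close>
lemma integrable_radial_weight:
  assumes s: "0 < s" "s < 1" and b: "0 \<le> b" "b < 2 * s"
  shows "integrable lborel (\<lambda>r::real. jump_weight b 1 r / \<bar>r\<bar> powr (1 + 2 * s))"
proof -
  let ?F = "\<lambda>r::real. jump_weight b 1 r / \<bar>r\<bar> powr (1 + 2 * s)"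
  let ?g = "\<lambda>r::real. 2 powr b * (indicator {0..1} r * r powr (1 - 2 * s) + indicator {1..} r * r powr (b - 1 - 2 * s))"
  have "integrable lebesgue (\<lambda>r. indicat_real {0..1} r *\<^sub>R r powr (1 - 2 * s))"
    by (rule nonnegative_absolutely_integrable_1 [unfolded set_integrable_def])
      (use s in \<open>auto intro: integrable_on_powr_from_0\<close>)
  then have i1: "integrable lborel (\<lambda>r. indicat_real {0..1} r * r powr (1 - 2 * s))"
    by (subst (asm) integrable_completion) auto
  have "integrable lebesgue (\<lambda>r. indicat_real {1..} r *\<^sub>R r powr (b - 1 - 2 * s))"
    by (rule nonnegative_absolutely_integrable_1 [unfolded set_integrable_def])
      (use s b has_integral_powr_to_inf[of "b - 1 - 2 * s" 1] in \<open>auto simp: integrable_on_def\<close>)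
  then have i2: "integrable lborel (\<lambda>r. indicat_real {1..} r * r powr (b - 1 - 2 * s))"
    by (subst (asm) integrable_completion) auto
  have ig: "integrable lborel ?g" using i1 i2 by simp
  then have ig': "integrable lborel (\<lambda>r. ?g (0 + (-1) * r))"
    by (rule lborel_integrable_real_affine) auto
  \<comment> \<open>The dominating function is supported on the positive half line; its reflection covers the
    negative one.\<close>
  have pos: "?F r \<le> ?g r" if r: "0 < r" for r
  proof (cases "r \<le> 1")
    case True
    have "(1 + r) powr b \<le> 2 powr b" using True r b by (intro powr_mono2) auto
    then have "?F r \<le> r\<^sup>2 * 2 powr b / r powr (1 + 2 * s)"
      using True r by (simp add: jump_weight_def min_absorb2 power_le_one divide_right_mono mult_left_mono)
    also have "\<dots> = 2 powr b * r powr (1 - 2 * s)"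
    proof -
      have "r powr (2 - (1 + 2 * s)) = r powr 2 / r powr (1 + 2 * s)" by (rule powr_diff)
      moreover have "r powr 2 = r\<^sup>2" using r by simp
      moreover have "2 - (1 + 2 * s) = 1 - 2 * s" by simp
      ultimately show ?thesis by (metis mult.commute times_divide_eq_left)
    qed
    also have "\<dots> \<le> ?g r" using True r by (intro mult_left_mono) (auto simp: indicator_def)
    finally show ?thesis .
  next
    case False
    have "(1 + r) powr b \<le> (2 * r) powr b" using False b by (intro powr_mono2) auto
    then have "(1 + r) powr b \<le> 2 powr b * r powr b" by (simp only: powr_mult)
    then have "?F r \<le> 2 powr b * r powr b / r powr (1 + 2 * s)"
      using False by (simp add: jump_weight_def min_absorb1 one_le_power divide_right_mono)
    also have "\<dots> = 2 powr b * r powr (b - 1 - 2 * s)"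
    proof -
      have "r powr (b - (1 + 2 * s)) = r powr b / r powr (1 + 2 * s)" by (rule powr_diff)
      moreover have "b - (1 + 2 * s) = b - 1 - 2 * s" by simp
      ultimately show ?thesis by (metis times_divide_eq_right)
    qed
    also have "\<dots> \<le> ?g r" using False by (intro mult_left_mono) (auto simp: indicator_def)
    finally show ?thesis .
  qed
  have even: "?F (- r) = ?F r" for r by (simp add: jump_weight_def)
  have g0: "0 \<le> ?g r" for r by simp
  have F0: "0 \<le> ?F r" for r by (simp add: jump_weight_nonneg)
  have sum: "?F r \<le> ?g r + ?g (- r)" for r
    using pos[of r] pos[of "- r"] g0[of r] g0[of "- r"] even[of r]
    by (cases r "0::real" rule: linorder_cases) auto
  then have bound: "\<bar>?F r\<bar> \<le> \<bar>?g r + ?g (0 + (-1) * r)\<bar>" for r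
  proof -
    have "\<bar>?F r\<bar> = ?F r" by (rule abs_of_nonneg[OF F0])
    also have "\<dots> \<le> ?g r + ?g (0 + (-1) * r)" using sum[of r] by (simp only: mult_minus1 add_0)
    also have "\<dots> \<le> \<bar>?g r + ?g (0 + (-1) * r)\<bar>" by (rule abs_ge_self)
    finally show ?thesis .
  qed
  show ?thesis
  proof (rule Bochner_Integration.integrable_bound[OF Bochner_Integration.integrable_add[OF ig ig']])
    show "?F \<in> borel_measurable lborel" by measurable
    show "AE r in lborel. norm (?F r) \<le> norm (?g r + ?g (0 + (-1) * r))"
      unfolding real_norm_def by (intro AE_I2 bound)
  qed
qed

lemma radial_weight_scaling:
  assumes "1 \<le> R"
  shows "(\<integral>r. jump_weight b R r / \<bar>r\<bar> powr (1 + 2 * s) \<partial>lborel)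
      = R powr (- 2 * s) * (\<integral>r. jump_weight b 1 r / \<bar>r\<bar> powr (1 + 2 * s) \<partial>lborel)"
    and "integrable lborel (\<lambda>r::real. jump_weight b R r / \<bar>r\<bar> powr (1 + 2 * s))
      \<longleftrightarrow> integrable lborel (\<lambda>r::real. jump_weight b 1 r / \<bar>r\<bar> powr (1 + 2 * s))"
proof -
  have R: "0 < R" using assms by simp
  have eq: "jump_weight b R (0 + R * r) / \<bar>0 + R * r\<bar> powr (1 + 2 * s)
      = R powr (- 1 - 2 * s) * (jump_weight b 1 r / \<bar>r\<bar> powr (1 + 2 * s))" for r :: real
  proof -
    have "jump_weight b R (0 + R * r) = jump_weight b 1 r"
      using R by (simp add: jump_weight_def abs_mult)
    moreover have "\<bar>0 + R * r\<bar> powr (1 + 2 * s) = R powr (1 + 2 * s) * \<bar>r\<bar> powr (1 + 2 * s)"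
      using R by (simp add: abs_mult powr_mult)
    moreover have "R powr (- 1 - 2 * s) = 1 / R powr (1 + 2 * s)"
      by (simp add: powr_minus_divide[symmetric])
    ultimately show ?thesis by simp
  qed
  have "(\<integral>r. jump_weight b R r / \<bar>r\<bar> powr (1 + 2 * s) \<partial>lborel)
      = \<bar>R\<bar> *\<^sub>R (\<integral>r. jump_weight b R (0 + R * r) / \<bar>0 + R * r\<bar> powr (1 + 2 * s) \<partial>lborel)"
    by (rule lborel_integral_real_affine) (use R in simp)
  also have "\<dots> = R * R powr (- 1 - 2 * s) * (\<integral>r. jump_weight b 1 r / \<bar>r\<bar> powr (1 + 2 * s) \<partial>lborel)"
    unfolding eq using R by (simp only: integral_mult_right_zero real_scaleR_def abs_of_pos mult.assoc)
  also have "R * R powr (- 1 - 2 * s) = R powr (- 2 * s)"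
  proof -
    have "R powr (1 + (- 1 - 2 * s)) = R powr 1 * R powr (- 1 - 2 * s)" by (rule powr_add)
    then show ?thesis using R by simp
  qed
  finally show "(\<integral>r. jump_weight b R r / \<bar>r\<bar> powr (1 + 2 * s) \<partial>lborel)
      = R powr (- 2 * s) * (\<integral>r. jump_weight b 1 r / \<bar>r\<bar> powr (1 + 2 * s) \<partial>lborel)" .
  have "integrable lborel (\<lambda>r::real. jump_weight b R r / \<bar>r\<bar> powr (1 + 2 * s))
     \<longleftrightarrow> integrable lborel (\<lambda>r::real. jump_weight b R (0 + R * r) / \<bar>0 + R * r\<bar> powr (1 + 2 * s))"
    by (rule lborel_integrable_real_affine_iff
      [where f = "\<lambda>r. jump_weight b R r / \<bar>r\<bar> powr (1 + 2 * s)" and c = R and t = 0, symmetric])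
      (use R in simp)
  also have "\<dots> \<longleftrightarrow> integrable lborel (\<lambda>r::real. jump_weight b 1 r / \<bar>r\<bar> powr (1 + 2 * s))"
    unfolding eq integrable_mult_left_iff using R by simp
  finally show "integrable lborel (\<lambda>r::real. jump_weight b R r / \<bar>r\<bar> powr (1 + 2 * s))
      \<longleftrightarrow> integrable lborel (\<lambda>r::real. jump_weight b 1 r / \<bar>r\<bar> powr (1 + 2 * s))" .
qed

text \<open>Polar coordinates: the image on the whole space of the measure that \<open>stable_op\<close> integrates
  against. The value \<open>1 / 0 = 0\<close> gives the density \<open>0\<close> at \<open>r = 0\<close>, so the origin is a null set.\<close>
definition stable_levy_measure :: "(real ^ 'n) measure \<Rightarrow> real \<Rightarrow> (real ^ 'n) measure" where
  "stable_levy_measure \<mu> s =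
    distr (density (\<mu> \<Otimes>\<^sub>M lborel) (\<lambda>(\<theta>, r). ennreal (1 / \<bar>r\<bar> powr (1 + 2 * s)))) borel (\<lambda>(\<theta>, r). r *\<^sub>R \<theta>)"

text \<open>The last assumption says that the measure is not concentrated on a hyperplane through the origin; it is the
  qualitative content of the lower bound on the spectral measure.\<close>
locale spectral_measure = finite_measure \<mu> for \<mu> :: "(real ^ 'n) measure" and s :: real +
  assumes s01: "0 < s" "s < 1"
    and sets_mu: "sets \<mu> = sets (restrict_space borel (sphere 0 1))"
    and nondegenerate: "\<And>e. norm e = 1 \<Longrightarrow> (\<integral>\<^sup>+\<theta>. ennreal (\<bar>e \<bullet> \<theta>\<bar> powr (2 * s)) \<partial>\<mu>) \<noteq> 0"
begin

sublocale P: pair_sigma_finite \<mu> lborel ..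

lemma space_mu: "space \<mu> = sphere 0 1"
  using sets_eq_imp_space_eq[OF sets_mu] by (simp add: space_restrict_space)

lemma measurable_id_mu [measurable]: "(\<lambda>\<theta>. \<theta>) \<in> borel_measurable \<mu>"
  unfolding measurable_cong_sets[OF sets_mu refl] by (rule measurable_restrict_space1) simp

lemma measurable_polar [measurable]: "(\<lambda>(\<theta>, r). r *\<^sub>R \<theta>) \<in> borel_measurable (\<mu> \<Otimes>\<^sub>M lborel)"
  by measurable

lemma sets_stable_levy_measure: "sets (stable_levy_measure \<mu> s) = sets borel"
  by (simp add: stable_levy_measure_def)

lemma integrable_stable_levy_iff:
  assumes [measurable]: "h \<in> borel_measurable borel"
  shows "integrable (stable_levy_measure \<mu> s) h
    \<longleftrightarrow> integrable (\<mu> \<Otimes>\<^sub>M lborel) (\<lambda>(\<theta>, r). h (r *\<^sub>R \<theta>) / \<bar>r\<bar> powr (1 + 2 * s) :: real)"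
proof -
  have "integrable (stable_levy_measure \<mu> s) h \<longleftrightarrow>
    integrable (density (\<mu> \<Otimes>\<^sub>M lborel) (\<lambda>p. ennreal (case p of (\<theta>, r) \<Rightarrow> 1 / \<bar>r\<bar> powr (1 + 2 * s)))) (\<lambda>p. h (case p of (\<theta>, r) \<Rightarrow> r *\<^sub>R \<theta>))"
    unfolding stable_levy_measure_def by (subst integrable_distr_eq) (auto simp: split_beta')
  also have "\<dots> \<longleftrightarrow> integrable (\<mu> \<Otimes>\<^sub>M lborel) (\<lambda>p. (case p of (\<theta>, r) \<Rightarrow> 1 / \<bar>r\<bar> powr (1 + 2 * s)) *\<^sub>R h (case p of (\<theta>, r) \<Rightarrow> r *\<^sub>R \<theta>))"
    by (rule integrable_density) (auto simp: split_beta')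
  finally show ?thesis by (simp add: split_beta')
qed

lemma integral_stable_levy:
  assumes [measurable]: "h \<in> borel_measurable borel"
  shows "(\<integral>z. h z \<partial>stable_levy_measure \<mu> s)
    = (\<integral>(\<theta>, r). h (r *\<^sub>R \<theta>) / \<bar>r\<bar> powr (1 + 2 * s) \<partial>(\<mu> \<Otimes>\<^sub>M lborel) :: real)"
proof -
  have "(\<integral>z. h z \<partial>stable_levy_measure \<mu> s) =
    (\<integral>p. h (case p of (\<theta>, r) \<Rightarrow> r *\<^sub>R \<theta>) \<partial>density (\<mu> \<Otimes>\<^sub>M lborel) (\<lambda>p. ennreal (case p of (\<theta>, r) \<Rightarrow> 1 / \<bar>r\<bar> powr (1 + 2 * s))))"
    unfolding stable_levy_measure_def by (subst integral_distr) (auto simp: split_beta')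
  also have "\<dots> = (\<integral>p. (case p of (\<theta>, r) \<Rightarrow> 1 / \<bar>r\<bar> powr (1 + 2 * s)) *\<^sub>R h (case p of (\<theta>, r) \<Rightarrow> r *\<^sub>R \<theta>) \<partial>(\<mu> \<Otimes>\<^sub>M lborel))"
    by (rule integral_density) (auto simp: split_beta')
  finally show ?thesis by (simp add: split_beta')
qed

lemma stable_op_eq_levy_op:
  assumes "u \<in> borel_measurable borel"
  shows "stable_op \<mu> s u x = levy_op (stable_levy_measure \<mu> s) u x"
proof -
  note assms[measurable]
  have "second_diff u x \<in> borel_measurable borel" unfolding second_diff_def by measurable
  from integral_stable_levy[OF this] show ?thesis
    unfolding stable_op_def levy_op_def second_diff_def by simp
qed

lemma jump_weight_polar:
  assumes "\<theta> \<in> space \<mu>"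
  shows "jump_weight b R (r *\<^sub>R \<theta>) = jump_weight b R r"
  using assms by (simp add: jump_weight_def space_mu)

lemma jump_weight_stable_levy:
  assumes b: "0 \<le> b" "b < 2 * s" and R: "1 \<le> R"
  shows "integrable (stable_levy_measure \<mu> s) (jump_weight b R)"
    and "(\<integral>z. jump_weight b R z \<partial>stable_levy_measure \<mu> s)
      = (measure \<mu> (space \<mu>) * (\<integral>r. jump_weight b 1 r / \<bar>r\<bar> powr (1 + 2 * s) \<partial>lborel)) * R powr (- 2 * s)"
proof -
  let ?h = "\<lambda>r::real. jump_weight b R r / \<bar>r\<bar> powr (1 + 2 * s)"
  have h: "integrable lborel ?h"
    using integrable_radial_weight[OF s01 b] radial_weight_scaling(2)[OF R] by blast
  have prod: "integrable (\<mu> \<Otimes>\<^sub>M lborel) (\<lambda>(\<theta>, r). ?h r)"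
  proof (rule P.integrable_dominated_by_product)
    show "(\<lambda>(\<theta>, r). ?h r) \<in> borel_measurable (\<mu> \<Otimes>\<^sub>M lborel)" by measurable
    show "integrable \<mu> (\<lambda>_. 1 :: real)" by simp
    show "integrable lborel ?h" by (rule h)
    show "\<bar>?h r\<bar> \<le> 1 * ?h r" for r using jump_weight_nonneg[of b R r] by simp
  qed
  have cong: "(case p of (\<theta>, r) \<Rightarrow> jump_weight b R (r *\<^sub>R \<theta>) / \<bar>r\<bar> powr (1 + 2 * s)) = (case p of (\<theta>, r) \<Rightarrow> ?h r)"
    if "p \<in> space (\<mu> \<Otimes>\<^sub>M lborel)" for p
  proof (cases p)
    case (Pair \<theta> r)
    then have "\<theta> \<in> space \<mu>" using that by (simp add: space_pair_measure)
    then show ?thesis using Pair by (simp add: jump_weight_polar)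
  qed
  have "integrable (\<mu> \<Otimes>\<^sub>M lborel) (\<lambda>(\<theta>, r). jump_weight b R (r *\<^sub>R \<theta>) / \<bar>r\<bar> powr (1 + 2 * s))"
    using prod by (subst Bochner_Integration.integrable_cong[OF refl cong])
  then show "integrable (stable_levy_measure \<mu> s) (jump_weight b R)"
    by (subst integrable_stable_levy_iff) auto
  have "(\<integral>z. jump_weight b R z \<partial>stable_levy_measure \<mu> s)
      = (\<integral>(\<theta>, r). jump_weight b R (r *\<^sub>R \<theta>) / \<bar>r\<bar> powr (1 + 2 * s) \<partial>(\<mu> \<Otimes>\<^sub>M lborel))"
    by (rule integral_stable_levy) simp
  also have "\<dots> = (\<integral>(\<theta>, r). ?h r \<partial>(\<mu> \<Otimes>\<^sub>M lborel))"
    by (rule Bochner_Integration.integral_cong[OF refl cong])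
  also have "\<dots> = (\<integral>\<theta>. (\<integral>r. ?h r \<partial>lborel) \<partial>\<mu>)"
    by (rule P.integral_fst[OF prod, symmetric])
  also have "\<dots> = measure \<mu> (space \<mu>) * (\<integral>r. ?h r \<partial>lborel)" by simp
  finally show "(\<integral>z. jump_weight b R z \<partial>stable_levy_measure \<mu> s)
      = (measure \<mu> (space \<mu>) * (\<integral>r. jump_weight b 1 r / \<bar>r\<bar> powr (1 + 2 * s) \<partial>lborel)) * R powr (- 2 * s)"
    unfolding radial_weight_scaling(1)[OF R] by (simp add: mult_ac)
qed

lemma AE_stable_levy:
  assumes "closed {z. Q z}" and ae: "AE z in stable_levy_measure \<mu> s. Q z"
  shows "AE \<theta> in \<mu>. AE r in lborel. r \<noteq> 0 \<longrightarrow> Q (r *\<^sub>R \<theta>)"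
proof -
  have [measurable]: "{z. Q z} \<in> sets borel" using assms(1) by auto
  have "AE p in density (\<mu> \<Otimes>\<^sub>M lborel) (\<lambda>(\<theta>, r). ennreal (1 / \<bar>r\<bar> powr (1 + 2 * s))). Q (case p of (\<theta>, r) \<Rightarrow> r *\<^sub>R \<theta>)"
    using ae unfolding stable_levy_measure_def by (subst (asm) AE_distr_iff) (auto simp: split_beta')
  then have "AE p in \<mu> \<Otimes>\<^sub>M lborel. 0 < (case p of (\<theta>, r) \<Rightarrow> ennreal (1 / \<bar>r\<bar> powr (1 + 2 * s))) \<longrightarrow> Q (case p of (\<theta>, r) \<Rightarrow> r *\<^sub>R \<theta>)"
    by (subst (asm) AE_density) (auto simp: split_beta')
  then have "AE \<theta> in \<mu>. AE r in lborel. 0 < (case (\<theta>, r) of (\<theta>, r) \<Rightarrow> ennreal (1 / \<bar>r\<bar> powr (1 + 2 * s))) \<longrightarrow> Q (case (\<theta>, r) of (\<theta>, r) \<Rightarrow> r *\<^sub>R \<theta>)"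
    by (rule P.AE_pair)
  then show ?thesis by simp
qed

text \<open>The image of a sigma-finite measure need not be sigma-finite. Here the complements of balls around the origin have
  finite measure and the origin is a null set.\<close>
lemma sigma_finite_stable_levy: "sigma_finite_measure (stable_levy_measure \<mu> s)"
proof
  let ?\<nu> = "stable_levy_measure \<mu> s"
  define A where "A n = {z :: real ^ 'n. 1 / real (Suc n) \<le> norm z}" for n
  have cA: "closed (A n)" for n unfolding A_def by (intro closed_Collect_le continuous_intros)
  have A_sets: "A n \<in> sets ?\<nu>" for n using cA by (simp add: sets_stable_levy_measure)
  have fin: "emeasure ?\<nu> (A n) \<noteq> \<infinity>" for n
  proof -
    have "integrable ?\<nu> (jump_weight 0 1 :: real ^ 'n \<Rightarrow> real)"
      using jump_weight_stable_levy(1)[of 0 1] s01 by simp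
    then have "integrable ?\<nu> (\<lambda>z. (real (Suc n))\<^sup>2 * jump_weight 0 1 z)" by simp
    then have "integrable ?\<nu> (indicator (A n) :: _ \<Rightarrow> real)"
    proof (rule Bochner_Integration.integrable_bound)
      show "indicator (A n) \<in> borel_measurable ?\<nu>" using A_sets by simp
      show "AE z in ?\<nu>. norm (indicator (A n) z :: real) \<le> norm ((real (Suc n))\<^sup>2 * jump_weight 0 1 z)"
      proof (rule AE_I2)
        fix z :: "real ^ 'n"
        show "norm (indicator (A n) z :: real) \<le> norm ((real (Suc n))\<^sup>2 * jump_weight 0 1 z)"
        proof (cases "z \<in> A n")
          case True
          then have z: "1 / real (Suc n) \<le> norm z" by (simp add: A_def)
          then have "0 < norm z" by (meson less_le_trans of_nat_0_less_iff zero_less_Suc zero_less_divide_1_iff)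
          then have "1 + norm z \<noteq> 0" by linarith
          then have jw: "jump_weight 0 1 z = min 1 ((norm z)\<^sup>2)" by (simp add: jump_weight_def)
          have "1 \<le> real (Suc n) * norm z" using z by (simp add: pos_divide_le_eq mult.commute del: of_nat_Suc)
          then have "1 \<le> (real (Suc n) * norm z)\<^sup>2" by (rule one_le_power)
          moreover have "1 \<le> (real (Suc n))\<^sup>2" by (rule one_le_power) simp
          ultimately have "1 \<le> (real (Suc n))\<^sup>2 * jump_weight 0 1 z"
            unfolding jw min_def power_mult_distrib by simp
          then show ?thesis using True by simp
        qed simp
      qed
    qed
    then have "emeasure ?\<nu> (A n \<inter> space ?\<nu>) < \<infinity>" by (simp only: integrable_indicator_iff)
    then show ?thesis using sets.sets_into_space[OF A_sets[of n]] by (simp add: inf.absorb1)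
  qed
  have zero: "emeasure ?\<nu> {0} = 0"
  proof -
    have Z: "(\<lambda>(\<theta>, r). r *\<^sub>R \<theta>) -` {0} \<inter> space (\<mu> \<Otimes>\<^sub>M lborel) \<in> sets (\<mu> \<Otimes>\<^sub>M lborel)"
      by (rule measurable_sets[OF measurable_polar]) simp
    have "emeasure ?\<nu> {0} = emeasure (density (\<mu> \<Otimes>\<^sub>M lborel) (\<lambda>(\<theta>, r). ennreal (1 / \<bar>r\<bar> powr (1 + 2 * s))))
        ((\<lambda>(\<theta>, r). r *\<^sub>R \<theta>) -` {0} \<inter> space (\<mu> \<Otimes>\<^sub>M lborel))"
      unfolding stable_levy_measure_def by (subst emeasure_distr) (auto simp: split_beta')
    also have "\<dots> = (\<integral>\<^sup>+p. (case p of (\<theta>, r) \<Rightarrow> ennreal (1 / \<bar>r\<bar> powr (1 + 2 * s)))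
        * indicator ((\<lambda>(\<theta>, r). r *\<^sub>R \<theta>) -` {0} \<inter> space (\<mu> \<Otimes>\<^sub>M lborel)) p \<partial>(\<mu> \<Otimes>\<^sub>M lborel))"
      by (rule emeasure_density[OF _ Z]) measurable
    also have "\<dots> = (\<integral>\<^sup>+p. 0 \<partial>(\<mu> \<Otimes>\<^sub>M (lborel :: real measure)))"
      by (rule nn_integral_cong) (auto simp: indicator_def space_pair_measure space_mu)
    finally show ?thesis by simp
  qed
  have "\<exists>n. z \<in> A n" if "z \<noteq> 0" for z
  proof -
    have "0 < norm z" using that by simp
    then obtain n where "inverse (real (Suc n)) < norm z" using reals_Archimedean by blast
    then have "z \<in> A n" unfolding A_def by (simp add: inverse_eq_divide del: of_nat_Suc)
    then show ?thesis ..
  qed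
  then have "\<Union> (insert {0} (range A)) = UNIV" by blast
  moreover have "space ?\<nu> = UNIV" by (simp add: stable_levy_measure_def)
  ultimately show "\<exists>S. countable S \<and> S \<subseteq> sets ?\<nu> \<and> \<Union> S = space ?\<nu> \<and> (\<forall>a\<in>S. emeasure ?\<nu> a \<noteq> \<infinity>)"
    using A_sets fin zero by (intro exI[of _ "insert {0} (range A)"]) (auto simp: sets_stable_levy_measure)
qed

text \<open>For almost every direction \<open>\<theta>\<close>, almost all short multiples of \<open>\<theta>\<close> lie in \<open>P\<close>; as \<open>P\<close> is closed, all
  short multiples do, and by addition all multiples. Such directions form a linear subspace \<open>L\<close>.
  A vector orthogonal to a proper \<open>L\<close> would be orthogonal to almost every direction, which is
  excluded.\<close>
lemma stable_levy_spanning: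
  assumes P: "closed P" "0 \<in> P" "\<And>x y. x \<in> P \<Longrightarrow> y \<in> P \<Longrightarrow> x + y \<in> P" "\<And>x. x \<in> P \<Longrightarrow> - x \<in> P"
    and ae: "AE z in stable_levy_measure \<mu> s. norm z \<le> 1 \<longrightarrow> z \<in> P"
  shows "P = UNIV"
proof -
  define L where "L = {\<theta>. \<forall>r. r *\<^sub>R \<theta> \<in> P}"
  have nat_mult: "real n *\<^sub>R y \<in> P" if "y \<in> P" for n y
    using that P(2,3) by (induction n) (auto simp: scaleR_left_distrib)
  have "AE \<theta> in \<mu>. AE r in lborel. r \<noteq> 0 \<longrightarrow> (norm (r *\<^sub>R \<theta>) < 1 \<longrightarrow> r *\<^sub>R \<theta> \<in> P)"
  proof (rule AE_stable_levy)
    have "{z. norm z < 1 \<longrightarrow> z \<in> P} = - ball 0 1 \<union> P" by auto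
    then show "closed {z. norm z < 1 \<longrightarrow> z \<in> P}" using P(1) by (auto intro!: closed_Un)
    show "AE z in stable_levy_measure \<mu> s. norm z < 1 \<longrightarrow> z \<in> P"
      using ae by eventually_elim auto
  qed
  then have "AE \<theta> in \<mu>. \<theta> \<in> L"
    using AE_space
  proof eventually_elim
    case (elim \<theta>)
    have n1: "norm \<theta> = 1" using elim(2) by (simp add: space_mu)
    have "ball 0 1 \<subseteq> {r. r *\<^sub>R \<theta> \<in> P}"
    proof (rule AE_closed_imp_subset)
      show "closed {r. r *\<^sub>R \<theta> \<in> P}"
        using closed_vimage[OF P(1), of "\<lambda>r. r *\<^sub>R \<theta>"] by (simp add: vimage_def continuous_intros)
      show "AE r in lborel. r \<in> ball 0 1 \<longrightarrow> r \<in> {r. r *\<^sub>R \<theta> \<in> P}"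
        using elim(1) by eventually_elim (use n1 P(2) in auto)
    qed auto
    then have small: "r *\<^sub>R \<theta> \<in> P" if "\<bar>r\<bar> < 1" for r using that by auto
    have "r *\<^sub>R \<theta> \<in> P" for r
    proof -
      obtain n :: nat where n: "\<bar>r\<bar> < real n" using reals_Archimedean2 by blast
      then have "\<bar>r / real n\<bar> < 1" by simp
      from nat_mult[OF small[OF this], of n] show ?thesis using n by simp
    qed
    then show ?case by (simp add: L_def)
  qed
  have "subspace L"
    unfolding subspace_def L_def using P by (auto simp: scaleR_right_distrib)
  have "span L = UNIV"
  proof (rule ccontr)
    assume "span L \<noteq> UNIV"
    then obtain a where a: "a \<noteq> 0" "\<forall>x\<in>span L. a \<bullet> x = 0" using span_not_UNIV_orthogonal by blast
    define e where "e = a /\<^sub>R norm a"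
    have e: "norm e = 1" using a by (simp add: e_def)
    have "(\<integral>\<^sup>+\<theta>. ennreal (\<bar>e \<bullet> \<theta>\<bar> powr (2 * s)) \<partial>\<mu>) = (\<integral>\<^sup>+\<theta>. 0 \<partial>\<mu>)"
    proof (rule nn_integral_cong_AE)
      show "AE \<theta> in \<mu>. ennreal (\<bar>e \<bullet> \<theta>\<bar> powr (2 * s)) = 0"
        using \<open>AE \<theta> in \<mu>. \<theta> \<in> L\<close>
      proof eventually_elim
        case (elim \<theta>)
        then have "e \<bullet> \<theta> = 0" using a(2) span_base[of \<theta> L] by (simp add: e_def)
        then show ?case by simp
      qed
    qed
    then show False using nondegenerate[OF e] by simp
  qed
  then have "L = UNIV" using \<open>subspace L\<close> by (simp add: span_eq_iff[THEN iffD2])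
  then have "1 *\<^sub>R x \<in> P" for x unfolding L_def by blast
  then show ?thesis by auto
qed

lemma levy_scaling_stable:
  assumes "0 \<le> \<kappa>" "\<kappa> < 2 * s"
  shows "levy_scaling (stable_levy_measure \<mu> s) s \<kappa>
    (measure \<mu> (space \<mu>) * (\<integral>r. jump_weight \<kappa> 1 r / \<bar>r\<bar> powr (1 + 2 * s) \<partial>lborel))"
proof (rule levy_scaling.intro)
  show "\<kappa> < 2" using assms s01 by simp
  show "0 < s" by (rule s01)
  show "0 \<le> \<kappa>" by (rule assms)
  show "sigma_finite_measure (stable_levy_measure \<mu> s)" by (rule sigma_finite_stable_levy)
  show "sets (stable_levy_measure \<mu> s) = sets borel" by (rule sets_stable_levy_measure)
  show "integrable (stable_levy_measure \<mu> s) (jump_weight \<kappa> R)" if "1 \<le> R" for R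
    by (rule jump_weight_stable_levy(1)[OF assms that])
  show "(\<integral>z. jump_weight \<kappa> R z \<partial>stable_levy_measure \<mu> s)
    \<le> (measure \<mu> (space \<mu>) * (\<integral>r. jump_weight \<kappa> 1 r / \<bar>r\<bar> powr (1 + 2 * s) \<partial>lborel)) * R powr (- 2 * s)"
    if "1 \<le> R" for R
    using jump_weight_stable_levy(2)[OF assms that] by (rule eq_refl)
qed (rule stable_levy_spanning)

end

section \<open>Classification of the solutions\<close>

text \<open>Vanishing mixed differences make \<open>u - u 0\<close> additive. It then equals \<open>n\<close> times its value at \<open>x / n\<close>, which
  tends to the derivative at the origin in the direction \<open>x\<close>.\<close>
lemma affine_if_mixed_diff_eq_0:
  fixes u :: "real ^ 'n \<Rightarrow> real"
  assumes md: "\<And>a b x. mixed_diff u a b x = 0" and T: "(u has_derivative T) (at 0)"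
  shows "u x = adjoint T 1 \<bullet> x + u 0"
proof -
  define L where "L x = u x - u 0" for x
  have L0: "L 0 = 0" by (simp add: L_def)
  have add: "L (a + b) = L a + L b" for a b
    using md[of a b 0] by (simp add: mixed_diff_def L_def)
  have nat: "L (real n *\<^sub>R a) = real n * L a" for n a
    by (induction n) (auto simp: L0 add scaleR_left_distrib algebra_simps)
  have linT: "linear T" using T has_derivative_linear by blast
  have der: "((\<lambda>t. u (t *\<^sub>R x)) has_derivative (\<lambda>t. T (t *\<^sub>R x))) (at 0)"
    by (rule has_derivative_compose[where g = u and f = "\<lambda>t. t *\<^sub>R x"])
      (use T in \<open>auto intro!: derivative_eq_intros\<close>)
  have "((\<lambda>t. u (t *\<^sub>R x)) has_field_derivative T x) (at 0)"
  proof -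
    have "(\<lambda>t. T (t *\<^sub>R x)) = (*) (T x)"
      by (rule ext) (simp add: linear_scale[OF linT])
    with der show ?thesis
      unfolding has_field_derivative_def by (simp only:)
  qed
  then have "((\<lambda>h. (u ((0 + h) *\<^sub>R x) - u (0 *\<^sub>R x)) / h) \<longlongrightarrow> T x) (at 0)"
    by (simp add: DERIV_def)
  moreover have "filterlim (\<lambda>n. 1 / real (Suc n)) (at 0) sequentially"
    unfolding filterlim_at using LIMSEQ_inverse_real_of_nat by (simp add: inverse_eq_divide)
  ultimately have "(\<lambda>n. (u ((0 + 1 / real (Suc n)) *\<^sub>R x) - u (0 *\<^sub>R x)) / (1 / real (Suc n))) \<longlonglongrightarrow> T x"
    by (rule filterlim_compose)
  moreover have "(u ((0 + 1 / real (Suc n)) *\<^sub>R x) - u (0 *\<^sub>R x)) / (1 / real (Suc n)) = L x" for n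
    using nat[of "Suc n" "(1 / real (Suc n)) *\<^sub>R x"] by (simp add: L_def mult.commute del: of_nat_Suc)
  ultimately have "L x = T x" using LIMSEQ_unique[OF tendsto_const] by simp
  moreover have "T x = adjoint T 1 \<bullet> x"
    using adjoint_works[OF linT, of x 1] by (simp add: inner_commute)
  ultimately show ?thesis by (simp add: L_def)
qed

theorem theorem1:
  fixes s lam \<Lambda> K \<kappa> :: real
    and \<mu> :: "(real ^ 'n) measure"
    and f :: "real \<Rightarrow> real"
    and u :: "real ^ 'n \<Rightarrow> real"
  assumes s: "0 < s" "s < 1"
    and mu_sphere: "sets \<mu> = sets (restrict_space borel (sphere 0 1))"
    and lam: "0 < lam"
    and Lam: "0 < \<Lambda>"
    and mu_lower: "ennreal lam \<le>
      (INF \<nu>\<in>sphere 0 1. \<integral>\<^sup>+\<theta>. ennreal (\<bar>\<nu> \<bullet> \<theta>\<bar> powr (2 * s)) \<partial>\<mu>)"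
    and mu_upper: "emeasure \<mu> (sphere 0 1) \<le> ennreal \<Lambda>"
    and f_cont: "continuous_on UNIV f"
    and f_mono: "mono f"
    and u_C2: "C2 u"
    and u_sol: "\<And>x. stable_op \<mu> s u x = f (u x)"
    and K: "0 \<le> K"
    and kappa: "0 \<le> \<kappa>" "\<kappa> < 2 * s"
    and u_growth: "\<And>x. \<bar>u x\<bar> \<le> K * (1 + rpow (norm x) \<kappa>)"
  shows "((\<exists>t. f t \<noteq> 0) \<longrightarrow> (\<exists>c. (\<forall>x. u x = c) \<and> f c = 0)) \<and>
    ((\<forall>t. f t = 0) \<longrightarrow>
      (\<exists>\<omega> c. (\<forall>x. u x = \<omega> \<bullet> x + c) \<and>
        (\<kappa> < 1 \<longrightarrow> \<omega> = 0 \<and> (\<forall>x. u x = c))))"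
proof -
  have sp: "space \<mu> = sphere 0 1"
    using sets_eq_imp_space_eq[OF mu_sphere] by (simp add: space_restrict_space)
  interpret finite_measure \<mu>
  proof
    show "emeasure \<mu> (space \<mu>) \<noteq> \<infinity>"
      using mu_upper unfolding sp by (auto simp: top_unique)
  qed
  interpret spectral_measure \<mu> s
  proof
    show "(\<integral>\<^sup>+\<theta>. ennreal (\<bar>e \<bullet> \<theta>\<bar> powr (2 * s)) \<partial>\<mu>) \<noteq> 0" if "norm e = 1" for e
    proof -
      have "e \<in> sphere 0 1" using that by simp
      then have "ennreal lam \<le> (\<integral>\<^sup>+\<theta>. ennreal (\<bar>e \<bullet> \<theta>\<bar> powr (2 * s)) \<partial>\<mu>)"
        by (rule order_trans[OF mu_lower INF_lower])
      then show ?thesis using lam by auto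
    qed
  qed (use s mu_sphere in auto)
  define \<nu> where "\<nu> = stable_levy_measure \<mu> s"
  interpret L: levy_scaling \<nu> s \<kappa>
    "measure \<mu> (space \<mu>) * (\<integral>r. jump_weight \<kappa> 1 r / \<bar>r\<bar> powr (1 + 2 * s) \<partial>lborel)"
    unfolding \<nu>_def by (rule levy_scaling_stable[OF kappa])
  have growth: "\<bar>u x\<bar> \<le> (2 * K) * (1 + norm x) powr \<kappa>" for x
  proof -
    have "rpow (norm x) \<kappa> \<le> (1 + norm x) powr \<kappa>"
    proof (cases "\<kappa> = 0")
      case True
      have "0 < 1 + norm x" by (simp add: add_pos_nonneg)
      then show ?thesis using True by (simp add: rpow_def)
    next
      case False
      have "norm x powr \<kappa> \<le> (1 + norm x) powr \<kappa>" by (rule powr_mono2[OF kappa(1)]) auto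
      with False show ?thesis by (simp add: rpow_def)
    qed
    moreover have "1 \<le> (1 + norm x) powr \<kappa>" using kappa by (simp add: ge_one_powr_ge_zero)
    ultimately have "K * (1 + rpow (norm x) \<kappa>) \<le> K * (2 * (1 + norm x) powr \<kappa>)"
      using K by (intro mult_left_mono) auto
    then show ?thesis using u_growth[of x] by simp
  qed
  have tame: "tame \<kappa> u" by (rule tame_C2[OF u_C2 growth])
  have op: "levy_op \<nu> u x = f (u x)" for x
    using u_sol[of x] stable_op_eq_levy_op[OF tame_measurable[OF tame]] by (simp add: \<nu>_def)
  \<comment> \<open>Any exponent strictly between \<open>\<kappa>\<close> and \<open>2 * s\<close> serves for the barrier.\<close>
  define b where "b = (\<kappa> + 2 * s) / 2"
  have b: "0 \<le> b" "\<kappa> < b" "b < 2 * s" "b < 2" using kappa s by (auto simp: b_def)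
  have intb: "integrable \<nu> (jump_weight b 1)"
    unfolding \<nu>_def by (rule jump_weight_stable_levy(1)[OF b(1,3)]) simp
  have "f (u x) \<le> 0" for x
    by (rule nonlinearity_nonpos[OF tame_cont[OF tame] growth kappa(1) b(2,4) intb
          L.integrable_second_diff[OF tame] f_cont f_mono op])
  moreover have "0 \<le> f (u x)" for x
  proof -
    have neg: "second_diff (\<lambda>x. - u x) y = (\<lambda>z. - second_diff u y z)" for y
      by (auto simp: second_diff_def)
    have "- f (- (- u x)) \<le> 0"
    proof (rule nonlinearity_nonpos[where u = "\<lambda>x. - u x" and f = "\<lambda>t. - f (- t)", OF _ _ kappa(1) b(2,4) intb])
      show "continuous_on UNIV (\<lambda>x. - u x)" by (intro continuous_intros tame_cont[OF tame])
      show "\<bar>- u x\<bar> \<le> (2 * K) * (1 + norm x) powr \<kappa>" for x using growth[of x] by simp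
      show "integrable \<nu> (second_diff (\<lambda>x. - u x) x)" for x
        unfolding neg using L.integrable_second_diff[OF tame] by simp
      show "continuous_on UNIV (\<lambda>t. - f (- t))"
        by (intro continuous_intros continuous_on_compose2[OF f_cont]) auto
      show "mono (\<lambda>t. - f (- t))" using f_mono by (auto simp: mono_def)
      show "levy_op \<nu> (\<lambda>x. - u x) x = - f (- (- u x))" for x
        using op[of x] unfolding levy_op_def neg by simp
    qed
    then show ?thesis by simp
  qed
  ultimately have fu: "f (u x) = 0" for x by (simp add: antisym)
  then have "L.harmonic u" using tame op by (simp add: L.harmonic_def)
  then have md: "mixed_diff u a b x = 0" for a b x by (rule L.harmonic_mixed_diff_eq_0)
  obtain T where "(u has_derivative T) (at 0)" using u_C2 unfolding C2_def by blast
  from affine_if_mixed_diff_eq_0[OF md this]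
  obtain \<omega> c where aff: "\<And>x. u x = \<omega> \<bullet> x + c" by blast
  have surj: "f t = 0" if "\<omega> \<noteq> 0" for t
  proof -
    have "u (((t - c) / (\<omega> \<bullet> \<omega>)) *\<^sub>R \<omega>) = t" using that by (simp add: aff)
    then show ?thesis using fu by metis
  qed
  \<comment> \<open>On the ray through \<open>\<omega>\<close> the function grows linearly, faster than \<open>t powr \<kappa>\<close>.\<close>
  have flat: "\<omega> = 0" if "\<kappa> < 1"
  proof (rule ccontr)
    assume w: "\<omega> \<noteq> 0"
    have bound: "\<bar>\<omega> \<bullet> \<omega> + c / t\<bar> \<le> (2 * K * (1 + norm \<omega>) powr \<kappa>) * t powr (\<kappa> - 1)" if t: "1 \<le> t" for t
    proof -
      have "1 + norm (t *\<^sub>R \<omega>) \<le> (1 + norm \<omega>) * t" using t by (simp add: algebra_simps)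
      then have "(1 + norm (t *\<^sub>R \<omega>)) powr \<kappa> \<le> ((1 + norm \<omega>) * t) powr \<kappa>"
        using kappa by (intro powr_mono2) auto
      then have "(1 + norm (t *\<^sub>R \<omega>)) powr \<kappa> \<le> (1 + norm \<omega>) powr \<kappa> * t powr \<kappa>" by (simp only: powr_mult)
      then have "2 * K * (1 + norm (t *\<^sub>R \<omega>)) powr \<kappa> \<le> 2 * K * ((1 + norm \<omega>) powr \<kappa> * t powr \<kappa>)"
        using K by (intro mult_left_mono) auto
      then have "\<bar>u (t *\<^sub>R \<omega>)\<bar> / t \<le> 2 * K * ((1 + norm \<omega>) powr \<kappa> * t powr \<kappa>) / t"
        using growth[of "t *\<^sub>R \<omega>"] t by (intro divide_right_mono) auto
      moreover have "\<bar>u (t *\<^sub>R \<omega>)\<bar> / t = \<bar>\<omega> \<bullet> \<omega> + c / t\<bar>"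
      proof -
        have "\<bar>u (t *\<^sub>R \<omega>)\<bar> / t = \<bar>u (t *\<^sub>R \<omega>) / t\<bar>" using t by simp
        also have "u (t *\<^sub>R \<omega>) / t = \<omega> \<bullet> \<omega> + c / t" using t by (simp add: aff add_divide_distrib)
        finally show ?thesis .
      qed
      moreover have "t powr (\<kappa> - 1) = t powr \<kappa> / t" using t by (simp add: powr_diff)
      ultimately show ?thesis by simp
    qed
    have "\<bar>\<omega> \<bullet> \<omega> + 0\<bar> \<le> 0"
    proof (rule tendsto_le)
      show "((\<lambda>t. (2 * K * (1 + norm \<omega>) powr \<kappa>) * t powr (\<kappa> - 1)) \<longlongrightarrow> 0) at_top"
        by (rule tendsto_mult_right_zero, rule tendsto_neg_powr[OF _ filterlim_ident]) (use that in simp)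
      have "((\<lambda>t::real. c / t) \<longlongrightarrow> 0) at_top"
        by (rule tendsto_divide_0[OF tendsto_const]) (rule filterlim_at_top_imp_at_infinity[OF filterlim_ident])
      then show "((\<lambda>t. \<bar>\<omega> \<bullet> \<omega> + c / t\<bar>) \<longlongrightarrow> \<bar>\<omega> \<bullet> \<omega> + 0\<bar>) at_top"
        by (intro tendsto_intros)
      show "\<forall>\<^sub>F t in at_top. \<bar>\<omega> \<bullet> \<omega> + c / t\<bar> \<le> (2 * K * (1 + norm \<omega>) powr \<kappa>) * t powr (\<kappa> - 1)"
        using eventually_ge_at_top[of 1] by eventually_elim (rule bound)
    qed auto
    moreover have "0 < \<omega> \<bullet> \<omega>" using w by simp
    ultimately show False by simp
  qed
  show ?thesis
  proof (intro conjI impI)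
    assume "\<exists>t. f t \<noteq> 0"
    then have "\<omega> = 0" using surj by blast
    then have "u x = c" for x by (simp add: aff)
    then show "\<exists>c. (\<forall>x. u x = c) \<and> f c = 0" using fu by metis
  next
    show "\<exists>\<omega> c. (\<forall>x. u x = \<omega> \<bullet> x + c) \<and> (\<kappa> < 1 \<longrightarrow> \<omega> = 0 \<and> (\<forall>x. u x = c))"
      using aff flat by (intro exI[of _ \<omega>] exI[of _ c]) auto
  qed
qed

end
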